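(* For every integer $n \ge 10$, there exists a chiral $4$-polytope (that is, a chiral abstract polytope of rank $4$) of Schläfli type $\{4,4,4\}$ whose automorphism group has order $2^n$.
   Context: An abstract polytope of rank $d$ (a $d$-polytope) is a partially ordered set $\mathcal{P}$ endowed with a strictly monotone rank function with range $\{-1,0,\dots,d\}$, satisfying (P1)-(P4) below. Elements of $\mathcal{P}$ are called faces, and elements of rank $j$ are called $j$-faces. Two faces $F,G$ are incident if $F\le G$ or $F\ge G$. A chain is a totally ordered subset of $\mathcal{P}$, and it has length $i$ if it contains exactly $i+1$ faces. Maximal chains are called flags. Two flags are $j$-adjacent if they differ in exactly one face, of rank $j$, and adjacent if they are $j$-adjacent for some $j$. For faces $F\le G$, the section $G/F$ is the set $\{H\in\mathcal{P} : F\le H\le G\}$, which has rank $\operatorname{rank}(G)-\operatorname{rank}(F)-1$; a section of rank $e$ is called an $e$-section. (P1) $\mathcal{P}$ has a least face $F_{-1}$ and a greatest face $F_d$. (P2) Each flag has length $d+1$ (so it has exactly $d+2$ faces, including $F_{-1}$ and $F_d$). (P3) Strong flag-connectedness: any two flags $\Phi,\Psi$ can be joined by a sequence of flags $\Phi=\Phi_0,\Phi_1,\dots,\Phi_k=\Psi$ with successive flags adjacent and each $\Phi_i$ containing $\Phi\cap\Psi$. (P4) Diamond condition: if $F<G$ are faces of ranks $i-1$ and $i+1$ respectively, where $0\le i\le d-1$, then there are precisely two $i$-faces $H$ with $F<H<G$. Every $2$-section of $\mathcal{P}$ is isomorphic to the face lattice of a polygon. $\mathcal{P}$ is equivelar of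 Schläfli type (or just type) $\{k_1,\dots,k_{d-1}\}$ if, for each $1\le i\le d-1$, every $2$-section $G/F$ with $F$ an $(i-2)$-face and $G$ an $(i+1)$-face incident with $F$ is the face lattice of a $k_i$-gon (i.e. has exactly $k_i$ edges). An automorphism of $\mathcal{P}$ is an order-preserving permutation of its elements (an automorphism of the poset, which preserves ranks), and the automorphism group of $\mathcal{P}$ is the group of all automorphisms under composition. $\mathcal{P}$ is chiral if its automorphism group has exactly two orbits on the set of flags, with every two adjacent flags lying in different orbits. *)

theory Defs
  imports "HOL-Algebra.Group_Action"
begin

text \<open>
  A poset is represented by its order relation \<open>r\<close> (with \<open>Partial_order r\<close>); its underlying
  set is \<open>Field r\<close>, and \<open>(F, G) \<in> r\<close> means \<open>F \<le> G\<close>.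
\<close>

definition order_isomorphism :: "'a rel \<Rightarrow> 'b rel \<Rightarrow> ('a \<Rightarrow> 'b) \<Rightarrow> bool" where
  "order_isomorphism r s f \<longleftrightarrow>
     bij_betw f (Field r) (Field s) \<and>
     (\<forall>x \<in> Field r. \<forall>y \<in> Field r. (x, y) \<in> r \<longleftrightarrow> (f x, f y) \<in> s)"

definition flags :: "'a rel \<Rightarrow> 'a set set" where
  "flags r = {\<Phi> \<in> Chains r. \<forall>C \<in> Chains r. \<Phi> \<subseteq> C \<longrightarrow> C = \<Phi>}"

definition adjacent_at :: "'a rel \<Rightarrow> ('a \<Rightarrow> int) \<Rightarrow> int \<Rightarrow> 'a set \<Rightarrow> 'a set \<Rightarrow> bool" where
  "adjacent_at r rank j \<Phi> \<Psi> \<longleftrightarrow>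
     \<Phi> \<in> flags r \<and> \<Psi> \<in> flags r \<and>
     (\<exists>F G. \<Phi> - \<Psi> = {F} \<and> \<Psi> - \<Phi> = {G} \<and> rank F = j \<and> rank G = j)"

definition adjacent :: "'a rel \<Rightarrow> ('a \<Rightarrow> int) \<Rightarrow> 'a set \<Rightarrow> 'a set \<Rightarrow> bool" where
  "adjacent r rank \<Phi> \<Psi> \<longleftrightarrow> (\<exists>j. adjacent_at r rank j \<Phi> \<Psi>)"

locale abstract_polytope =
  fixes r :: "'a rel" and rank :: "'a \<Rightarrow> int" and d :: nat
  assumes partial_order: "Partial_order r"
    and rank_strict_mono: "(F, G) \<in> r \<Longrightarrow> F \<noteq> G \<Longrightarrow> rank F < rank G"
    and rank_range: "rank ` Field r = {-1 .. int d}"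
    and least_face: "\<exists>F \<in> Field r. \<forall>G \<in> Field r. (F, G) \<in> r"
    and greatest_face: "\<exists>G \<in> Field r. \<forall>F \<in> Field r. (F, G) \<in> r"
    and flag_length: "\<Phi> \<in> flags r \<Longrightarrow> card \<Phi> = d + 2"
    and strongly_flag_connected: "\<Phi> \<in> flags r \<Longrightarrow> \<Psi> \<in> flags r \<Longrightarrow>
      (\<lambda>X Y. adjacent r rank X Y \<and> \<Phi> \<inter> \<Psi> \<subseteq> X \<and> \<Phi> \<inter> \<Psi> \<subseteq> Y)\<^sup>*\<^sup>* \<Phi> \<Psi>"
    and diamond: "0 \<le> i \<Longrightarrow> i \<le> int d - 1 \<Longrightarrow> (F, G) \<in> r \<Longrightarrow> F \<noteq> G \<Longrightarrow>
      rank F = i - 1 \<Longrightarrow> rank G = i + 1 \<Longrightarrow>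
      card {H. rank H = i \<and> (F, H) \<in> r \<and> F \<noteq> H \<and> (H, G) \<in> r \<and> H \<noteq> G} = 2"

text \<open>The section \<open>G/F\<close> with its induced order.\<close>

definition face_section :: "'a rel \<Rightarrow> 'a \<Rightarrow> 'a \<Rightarrow> 'a rel" where
  "face_section r G F = Restr r {H. (F, H) \<in> r \<and> (H, G) \<in> r}"

text \<open>
  The face lattice of the \<open>k\<close>-gon (\<open>k \<ge> 2\<close>), with vertices and edges numbered cyclically by
  \<open>0, ..., k - 1\<close>: the edge \<open>Edge j\<close> joins the vertices \<open>Vertex j\<close> and \<open>Vertex ((j + 1) mod k)\<close>.
\<close>

datatype polygon_face = Empty_Face | Vertex nat | Edge nat | Whole_Polygon

definition polygon_faces :: "nat \<Rightarrow> polygon_face set" where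
  "polygon_faces k = {Empty_Face, Whole_Polygon} \<union> Vertex ` {..<k} \<union> Edge ` {..<k}"

definition polygon_lattice :: "nat \<Rightarrow> polygon_face rel" where
  "polygon_lattice k =
     {(x, y) \<in> polygon_faces k \<times> polygon_faces k.
        x = y \<or> x = Empty_Face \<or> y = Whole_Polygon \<or>
        (\<exists>i j. x = Vertex i \<and> y = Edge j \<and> (i = j \<or> i = (j + 1) mod k))}"

text \<open>
  The \<open>d - 1\<close> entries of the Schlaefli type are listed as \<open>ks\<close>; lists are indexed from 0, so
  \<open>k\<^sub>i\<close> is \<open>ks ! (i - 1)\<close>.
\<close>

definition has_schlaefli_type :: "'a rel \<Rightarrow> ('a \<Rightarrow> int) \<Rightarrow> nat \<Rightarrow> nat list \<Rightarrow> bool" where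
  "has_schlaefli_type r rank d ks \<longleftrightarrow>
     length ks = d - 1 \<and>
     (\<forall>i \<in> {1..d - 1}. \<forall>F G. (F, G) \<in> r \<and> rank F = int i - 2 \<and> rank G = int i + 1 \<longrightarrow>
        (\<exists>f. order_isomorphism (face_section r G F) (polygon_lattice (ks ! (i - 1))) f))"

text \<open>
  As in \<open>BijGroup\<close>, automorphisms are taken to be extensional outside \<open>Field r\<close>, so that each
  permutation of the faces is represented by exactly one function.
\<close>

definition automorphism_group :: "'a rel \<Rightarrow> ('a \<Rightarrow> 'a) monoid" where
  "automorphism_group r =
     BijGroup (Field r) \<lparr>carrier := {f \<in> Bij (Field r). order_isomorphism r r f}\<rparr>"

definition flag_action :: "'a rel \<Rightarrow> ('a \<Rightarrow> 'a) \<Rightarrow> 'a set \<Rightarrow> 'a set" where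
  "flag_action r = (\<lambda>f. \<lambda>\<Phi> \<in> flags r. f ` \<Phi>)"

locale chiral_polytope = abstract_polytope +
  assumes two_flag_orbits:
      "card (orbits (automorphism_group r) (flags r) (flag_action r)) = 2"
    and adjacent_flags_different_orbits: "adjacent r rank \<Phi> \<Psi> \<Longrightarrow>
      orbit (automorphism_group r) (flag_action r) \<Phi> \<noteq>
      orbit (automorphism_group r) (flag_action r) \<Psi>"

end

theory Submission
  imports Defs "HOL-Library.Countable" "HOL-Library.Product_Plus"
begin

text \<open>
  Sending the last generating reflection of the Coxeter group \<open>[4,4,4]\<close> to the identity maps it onto
  the symmetry group \<open>[4,4]\<close> of the square tessellation; the kernel is generated by one involution
  \<open>e s\<close> for each square \<open>s\<close>, where the involutions of neighbouring squares commute. Hence, whenever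
  such involutions act on a set of facets, \<open>[4,4,4]\<close> acts on pairs of a facet \<open>c\<close> and a flag \<open>x\<close> of a
  toroidal quotient of the tessellation: the first three generators move \<open>x\<close>, and the last one
  replaces \<open>c\<close> by \<open>e s c\<close>, where \<open>s\<close> is the square of \<open>x\<close>. These pairs are the flags of a polytope of
  type \<open>{4,4,4}\<close> with toroidal facets. We use 32 facets, two copies of the group \<open>C\<^sub>2 \<times> D\<^sub>4\<close> of order 16
  interchanged by every \<open>e s\<close>, and let \<open>e s\<close> depend on \<open>s\<close> modulo the lattice generated by \<open>(2, 2)\<close> and
  \<open>(2, -2)\<close>. All orientation preserving symmetries of the torus lift to symmetries preserving the two
  copies and all reflections to symmetries interchanging them, but no symmetry over the identity of
  the torus interchanges the copies; this is chirality. The torus may be the quotient of the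
  Gaussian integers by any ideal \<open>(1 + i)\<^sup>k\<close> with \<open>k \<ge> 3\<close>, and then the group has order
  \<open>16 \<cdot> 8 \<cdot> 2\<^sup>k\<close>.
\<close>

section \<open>Flag graphs and their face posets\<close>

text \<open>Free of assumptions, so that \<open>conn\<close> and \<open>D\<close> are available for
  \<open>face_code\<close> before a flag graph has been established.\<close>

locale labelled_involutions =
  fixes d :: nat and act :: "int \<Rightarrow> 'x \<Rightarrow> 'x"
begin

text \<open>The labels are the ranks of the proper faces; \<open>R\<close> below adds the ranks of
  the least and the greatest face.\<close>

definition D :: "int set" where "D = {0..<int d}"

definition R :: "int set" where "R = {-1..int d}"

definition conn :: "int set \<Rightarrow> 'x \<Rightarrow> 'x \<Rightarrow> bool" where
  "conn I = (\<lambda>x y. \<exists>i\<in>I. y = act i x)\<^sup>*\<^sup>*"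

lemma conn_refl [simp]: "conn I x x"
  by (simp add: conn_def)

lemma conn_trans [trans]: "conn I x y \<Longrightarrow> conn I y z \<Longrightarrow> conn I x z"
  by (simp add: conn_def)

lemma conn_step: "i \<in> I \<Longrightarrow> conn I x (act i x)"
  unfolding conn_def by (rule r_into_rtranclp) auto

lemma conn_mono: "conn I x y \<Longrightarrow> I \<subseteq> J \<Longrightarrow> conn J x y"
  unfolding conn_def by (erule rtranclp_mono[THEN predicate2D, rotated]) auto

lemma conn_induct [consumes 1, case_names refl step]:
  assumes "conn I x y" "P x" "\<And>y i. conn I x y \<Longrightarrow> P y \<Longrightarrow> i \<in> I \<Longrightarrow> P (act i y)"
  shows "P y"
  using assms(1) unfolding conn_def
  by (induction rule: rtranclp_induct) (use assms(2,3) in \<open>auto simp: conn_def\<close>)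

end

text \<open>Abstracts the flags of a polytope: \<open>act i\<close> passes to the i-adjacent flag,
  and \<open>par\<close> is a two-colouring that separates adjacent flags. Condition
  \<open>intersection\<close> is the intersection property of the generators, stated for paths
  between flags.\<close>

locale flag_graph = labelled_involutions d act
  for d :: nat and act :: "int \<Rightarrow> 'x \<Rightarrow> 'x" +
  fixes X :: "'x set" and par :: "'x \<Rightarrow> bool"
  assumes X_nonempty: "X \<noteq> {}"
    and act_closed: "i \<in> D \<Longrightarrow> x \<in> X \<Longrightarrow> act i x \<in> X"
    and act_act: "i \<in> D \<Longrightarrow> x \<in> X \<Longrightarrow> act i (act i x) = x"
    and par_act: "i \<in> D \<Longrightarrow> x \<in> X \<Longrightarrow> par (act i x) \<longleftrightarrow> \<not> par x"
    and act_commute: "i \<in> D \<Longrightarrow> j \<in> D \<Longrightarrow> i + 1 < j \<Longrightarrow> x \<in> X \<Longrightarrow>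
          act i (act j x) = act j (act i x)"
    and connected: "x \<in> X \<Longrightarrow> y \<in> X \<Longrightarrow> conn D x y"
    and intersection: "J \<subseteq> D \<Longrightarrow> x \<in> X \<Longrightarrow> y \<in> X \<Longrightarrow>
          (\<And>j. j \<in> J \<Longrightarrow> conn (D - {j}) x y) \<Longrightarrow> conn (D - J) x y"
begin

section \<open>Paths with prescribed labels\<close>

lemma D_subset_R: "D \<subseteq> R"
  by (auto simp: D_def R_def)

lemma conn_closed: "conn I x y \<Longrightarrow> I \<subseteq> D \<Longrightarrow> x \<in> X \<Longrightarrow> y \<in> X"
  by (induction rule: conn_induct) (auto intro: act_closed)

lemma conn_sym: "conn I x y \<Longrightarrow> I \<subseteq> D \<Longrightarrow> x \<in> X \<Longrightarrow> conn I y x"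
proof (induction rule: conn_induct)
  case (step y i)
  then have "y \<in> X" using conn_closed by blast
  then have "conn I (act i y) y"
    using conn_step[of i I "act i y"] act_act[of i y] step by auto
  with step show ?case by (blast intro: conn_trans)
qed simp

lemma conn_empty: "conn {} x y \<longleftrightarrow> x = y"
  by (auto elim: conn_induct)

lemma conn_singleton:
  assumes "conn {i} x y" "i \<in> D" "x \<in> X"
  shows "y = x \<or> y = act i x"
  using assms by (induction rule: conn_induct) (auto simp: act_act)

text \<open>Labels at distance at least 2 commute, so each new step with label in \<open>I\<close>
  can be pulled back through the part of the path with labels in \<open>J\<close>.\<close>

lemma conn_split:
  assumes "conn (I \<union> J) x y" "I \<subseteq> D" "J \<subseteq> D" "x \<in> X"
    and far: "\<And>i j. i \<in> I \<Longrightarrow> j \<in> J \<Longrightarrow> i + 1 < j \<or> j + 1 < i"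
  shows "\<exists>m. conn I x m \<and> conn J m y"
  using assms(1)
proof (induction rule: conn_induct)
  case refl
  show ?case by (intro exI[of _ x]) simp
next
  case (step y i)
  then obtain m where m: "conn I x m" "conn J m y" by blast
  then have mX: "m \<in> X" using assms conn_closed by blast
  show ?case
  proof (cases "i \<in> J")
    case True
    then show ?thesis using m conn_trans conn_step by blast
  next
    case False
    then have i: "i \<in> I" using step by blast
    from m(2) have "conn J (act i m) (act i y)"
    proof (induction rule: conn_induct)
      case (step z j)
      note far = far[of i j]
      have "z \<in> X" using step(1) mX assms conn_closed by blast
      moreover have "i \<in> D" "j \<in> D" using i step assms by auto
      ultimately have "act i (act j z) = act j (act i z)"
        using act_commute[of i j z] act_commute[of j i z] far i step by auto
      then show ?case using step conn_trans conn_step by metis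
    qed simp
    then show ?thesis using m i conn_trans conn_step by blast
  qed
qed

end

text \<open>The faces of rank j are the components that remain when label j is deleted;
  \<open>face\<close> is any naming of them. For j = -1 or j = d nothing is deleted, so all flags
  share their improper faces.\<close>

locale flag_system = flag_graph d act X par
  for d :: nat and act :: "int \<Rightarrow> 'x \<Rightarrow> 'x" and X :: "'x set" and par :: "'x \<Rightarrow> bool" +
  fixes face :: "int \<Rightarrow> 'x \<Rightarrow> 'f" and rank :: "'f \<Rightarrow> int"
  assumes face_eq_iff: "j \<in> R \<Longrightarrow> k \<in> R \<Longrightarrow> x \<in> X \<Longrightarrow> y \<in> X \<Longrightarrow>
          face j x = face k y \<longleftrightarrow> j = k \<and> conn (D - {j}) x y"
    and rank_face: "j \<in> R \<Longrightarrow> x \<in> X \<Longrightarrow> rank (face j x) = j"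
begin

lemma face_eqD: "face j x = face k y \<Longrightarrow> j \<in> R \<Longrightarrow> k \<in> R \<Longrightarrow> x \<in> X \<Longrightarrow> y \<in> X \<Longrightarrow>
    j = k \<and> conn (D - {j}) x y"
  using face_eq_iff by blast

lemma face_cong:
  "conn I x y \<Longrightarrow> I \<subseteq> D - {j} \<Longrightarrow> j \<in> R \<Longrightarrow> x \<in> X \<Longrightarrow> face j y = face j x"
  using face_eq_iff[of j j x y] conn_mono[of I x y "D - {j}"] conn_closed[of I x y] by force

lemma face_act: "i \<in> D \<Longrightarrow> j \<in> R \<Longrightarrow> i \<noteq> j \<Longrightarrow> x \<in> X \<Longrightarrow> face j (act i x) = face j x"
  by (rule face_cong[OF conn_step[of i "{i}"]]) auto

lemma face_improper:
  assumes "j = -1 \<or> j = int d" "x \<in> X" "y \<in> X"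
  shows "face j x = face j y"
proof -
  have "D - {j} = D" "j \<in> R" using assms(1) by (auto simp: D_def R_def)
  then show ?thesis using face_eq_iff[of j j x y] connected assms by auto
qed

text \<open>Sharing the face of rank j means a path that avoids label j; \<open>intersection\<close>
  merges these paths into one that avoids all of \<open>J\<close>. Improper ranks in
  \<open>J\<close> delete no label.\<close>

lemma conn_of_faces:
  assumes "x \<in> X" "y \<in> X" "J \<subseteq> R" "\<And>j. j \<in> J \<Longrightarrow> face j x = face j y"
  shows "conn (D - J) x y"
proof -
  have "conn (D - {j}) x y" if "j \<in> J \<inter> D" for j
    using face_eqD[of j x j y] assms that by blast
  then have "conn (D - (J \<inter> D)) x y"
    by (rule intersection[rotated 3]) (use assms in auto)
  moreover have "D - J \<inter> D = D - J" by blast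
  ultimately show ?thesis by metis
qed

lemma eq_of_faces:
  assumes "x \<in> X" "y \<in> X" "\<And>j. j \<in> D \<Longrightarrow> face j x = face j y"
  shows "x = y"
proof -
  have "conn (D - D) x y" using conn_of_faces assms D_subset_R by blast
  then show ?thesis by (simp add: conn_empty)
qed

lemma act_neq: "i \<in> D \<Longrightarrow> x \<in> X \<Longrightarrow> act i x \<noteq> x"
  using par_act[of i x] by auto

lemma face_act_neq:
  assumes "i \<in> D" "x \<in> X"
  shows "face i (act i x) \<noteq> face i x"
proof
  assume *: "face i (act i x) = face i x"
  have "face j (act i x) = face j x" if "j \<in> D" for j
    using * face_act[of i j x] assms that D_subset_R by (cases "j = i") auto
  then have "act i x = x" using eq_of_faces[of "act i x" x] act_closed assms by blast
  then show False using act_neq assms by blast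
qed

text \<open>Deleting label j leaves the labels above j and those below j, which commute. By
  \<open>conn_split\<close> a path from \<open>x\<close> to \<open>z\<close> first uses the labels
  above j, keeping all lower faces of \<open>x\<close>, and then those below j, reaching
  \<open>z\<close> with its upper faces unchanged; \<open>m\<close> is the turning point.\<close>

lemma link:
  assumes "x \<in> X" "z \<in> X" "j \<in> R" "face j x = face j z"
  shows "\<exists>m\<in>X. (\<forall>i\<in>R. i \<le> j \<longrightarrow> face i m = face i x) \<and> (\<forall>i\<in>R. j \<le> i \<longrightarrow> face i m = face i z)"
proof -
  let ?U = "{i\<in>D. j < i}" and ?L = "{i\<in>D. i < j}"
  have "conn (D - {j}) x z" using assms face_eqD by blast
  moreover have "D - {j} = ?U \<union> ?L" by auto
  ultimately obtain m where m: "conn ?U x m" "conn ?L m z"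
    using conn_split[of ?U ?L x z] assms by fastforce
  have mX: "m \<in> X" using m(1) by (rule conn_closed) (use assms in auto)
  have "face i m = face i x" if "i \<in> R" "i \<le> j" for i
    by (rule face_cong[OF m(1)]) (use that assms in auto)
  moreover have "face i z = face i m" if "i \<in> R" "j \<le> i" for i
    by (rule face_cong[OF m(2)]) (use that mX in auto)
  ultimately show ?thesis using mX by (intro bexI[of _ m]) auto
qed

section \<open>The order on faces and the extension of chains to flags\<close>

definition face_order :: "'f rel" where
  "face_order = {(face j x, face k x) | j k x. j \<in> R \<and> k \<in> R \<and> j \<le> k \<and> x \<in> X}"

lemma face_orderI: "j \<in> R \<Longrightarrow> k \<in> R \<Longrightarrow> j \<le> k \<Longrightarrow> x \<in> X \<Longrightarrow> (face j x, face k x) \<in> face_order"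
  unfolding face_order_def by blast

lemma face_orderE:
  assumes "(F, G) \<in> face_order"
  obtains x where "x \<in> X" "F = face (rank F) x" "G = face (rank G) x" "rank F \<in> R" "rank G \<in> R"
    "rank F \<le> rank G"
  using assms rank_face unfolding face_order_def by auto

lemma face_order_rank: "(F, G) \<in> face_order \<Longrightarrow> rank F \<le> rank G"
  by (erule face_orderE)

lemma Field_face_order: "Field face_order = {face j x | j x. j \<in> R \<and> x \<in> X}"
proof
  show "Field face_order \<subseteq> {face j x | j x. j \<in> R \<and> x \<in> X}"
    by (auto simp: Field_def face_order_def)
  show "{face j x | j x. j \<in> R \<and> x \<in> X} \<subseteq> Field face_order"
    using face_orderI by (fastforce simp: Field_def)
qed

lemma FieldE:
  assumes "F \<in> Field face_order"
  obtains x where "x \<in> X" "F = face (rank F) x" "rank F \<in> R"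
  using assms rank_face unfolding Field_face_order by auto

lemma face_order_antisym_rank:
  assumes "(F, G) \<in> face_order" "rank F = rank G"
  shows "F = G"
proof -
  obtain x where "F = face (rank F) x" "G = face (rank G) x" using assms(1) by (rule face_orderE)
  then show ?thesis using assms(2) by metis
qed

text \<open>A flag through \<open>F\<close>, \<open>G\<close> and a flag through \<open>G\<close>,
  \<open>H\<close> are glued at \<open>G\<close> by \<open>link\<close>.\<close>

lemma face_order_trans:
  assumes "(F, G) \<in> face_order" "(G, H) \<in> face_order"
  shows "(F, H) \<in> face_order"
proof -
  obtain x where x: "x \<in> X" "F = face (rank F) x" "G = face (rank G) x" "rank F \<in> R" "rank G \<in> R"
    "rank F \<le> rank G" using assms(1) by (rule face_orderE)
  obtain z where z: "z \<in> X" "G = face (rank G) z" "H = face (rank H) z" "rank H \<in> R"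
    "rank G \<le> rank H" using assms(2) by (rule face_orderE)
  obtain m where m: "m \<in> X" "\<forall>i\<in>R. i \<le> rank G \<longrightarrow> face i m = face i x"
      "\<forall>i\<in>R. rank G \<le> i \<longrightarrow> face i m = face i z"
    using link[of x z "rank G"] x z by metis
  then have "face (rank F) m = F" "face (rank H) m = H" using x z by auto
  then show ?thesis using face_orderI[of "rank F" "rank H" m] x z m by auto
qed

lemma Partial_order_face_order: "Partial_order face_order"
proof -
  have "antisym face_order"
  proof (rule antisymI)
    fix F G assume FG: "(F, G) \<in> face_order" "(G, F) \<in> face_order"
    then have "rank F = rank G" by (blast intro: order_antisym dest: face_order_rank)
    then show "F = G" using FG face_order_antisym_rank by blast
  qed
  moreover have "trans face_order"
    using face_order_trans by (blast intro: transI)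
  moreover have "Refl face_order"
    by (auto simp: refl_on_def Field_face_order intro: face_orderI)
  ultimately show ?thesis
    by (auto simp: partial_order_on_def preorder_on_def Field_def)
qed

text \<open>The chain is absorbed from the bottom upwards, gluing one more face at a time by
  \<open>link\<close>.\<close>

lemma chain_common_flag:
  assumes "C \<in> Chains face_order"
  shows "\<exists>x\<in>X. \<forall>F\<in>C. F = face (rank F) x"
proof -
  have comp: "(F, G) \<in> face_order \<or> (G, F) \<in> face_order" if "F \<in> C" "G \<in> C" for F G
    using assms that by (auto simp: Chains_def)
  have rR: "rank F \<in> R" if "F \<in> C" for F using comp[OF that that] by (blast elim: face_orderE)
  have uniq: "F = G" if "F \<in> C" "G \<in> C" "rank F = rank G" for F G
    using comp[OF that(1,2)] that(3) face_order_antisym_rank by metis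
  \<comment> \<open>The shift by 1 makes the case n = 0 vacuous, since ranks start at -1; n = d + 2
    covers all ranks.\<close>
  have "\<exists>x\<in>X. \<forall>F\<in>C. rank F < int n - 1 \<longrightarrow> F = face (rank F) x" for n
  proof (induction n)
    case 0
    then show ?case using X_nonempty rR by (force simp: R_def)
  next
    case (Suc n)
    then obtain x where x: "x \<in> X" "\<forall>F\<in>C. rank F < int n - 1 \<longrightarrow> F = face (rank F) x" by blast
    show ?case
    proof (cases "\<exists>G\<in>C. rank G = int n - 1")
      case False
      then have "\<forall>F\<in>C. rank F < int (Suc n) - 1 \<longrightarrow> F = face (rank F) x"
        using x(2) by force
      then show ?thesis using x(1) by blast
    next
      case True
      then obtain G where G: "G \<in> C" "rank G = int n - 1" by blast
      let ?K = "rank ` {F\<in>C. rank F < int n - 1}"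
      show ?thesis
      proof (cases "?K = {}")
        case True
        obtain y where y: "y \<in> X" "G = face (rank G) y"
          using comp[OF G(1) G(1)] by (blast elim: face_orderE)
        have "F = face (rank F) y" if F: "F \<in> C" "rank F < int (Suc n) - 1" for F
        proof -
          have "rank F = rank G" using True F G by force
          then show ?thesis using uniq[OF F(1) G(1)] y by simp
        qed
        then show ?thesis using y(1) by blast
      next
        case False
        have "finite ?K" by (rule finite_subset[of _ R]) (use rR in \<open>auto simp: R_def\<close>)
        then have "Max ?K \<in> ?K" and max: "\<And>k. k \<in> ?K \<Longrightarrow> k \<le> Max ?K" using False by auto
        \<comment> \<open>\<open>F\<close> is the face of the chain just below \<open>G\<close>.
          Gluing at \<open>F\<close> keeps the faces up to \<open>F\<close> from \<open>x\<close>
          and takes \<open>G\<close> from a flag \<open>z\<close> through \<open>F\<close> and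
          \<open>G\<close>.\<close>
        then obtain F where F: "F \<in> C" "rank F < int n - 1" "rank F = Max ?K" by auto
        then have "(F, G) \<in> face_order"
          using comp[OF F(1) G(1)] G face_order_rank[of G F] by auto
        then obtain z where z: "z \<in> X" "F = face (rank F) z" "G = face (rank G) z"
          by (blast elim: face_orderE)
        moreover have "F = face (rank F) x" using x F by blast
        ultimately obtain m where m: "m \<in> X" "\<forall>i\<in>R. i \<le> rank F \<longrightarrow> face i m = face i x"
            "\<forall>i\<in>R. rank F \<le> i \<longrightarrow> face i m = face i z"
          using link[of x z "rank F"] x(1) rR[OF F(1)] by metis
        have "H = face (rank H) m" if H: "H \<in> C" "rank H < int (Suc n) - 1" for H
        proof (cases "rank H = rank G")
          case True
          then show ?thesis using uniq[OF H(1) G(1)] m(3) z F G rR[OF G(1)] by auto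
        next
          case False
          then have lt: "rank H < int n - 1" using H G by simp
          then have "rank H \<le> rank F" using max[of "rank H"] H F by auto
          then show ?thesis using m(2) x(2) H lt rR[OF H(1)] by auto
        qed
        then show ?thesis using m(1) by blast
      qed
    qed
  qed
  from this[of "d + 2"] obtain x where "x \<in> X" "\<forall>F\<in>C. rank F < int d + 1 \<longrightarrow> F = face (rank F) x"
    by auto
  then show ?thesis using rR by (force simp: R_def)
qed

section \<open>Maximal chains, adjacency and strong flag-connectedness\<close>

definition flag :: "'x \<Rightarrow> 'f set" where
  "flag x = (\<lambda>j. face j x) ` R"

lemma flag_chain: "x \<in> X \<Longrightarrow> flag x \<in> Chains face_order"
  unfolding Chains_def flag_def by clarsimp (metis face_orderI linear)

lemma flag_subset_iff:
  assumes "x \<in> X" "y \<in> X"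
  shows "flag x \<subseteq> flag y \<longleftrightarrow> x = y"
proof
  assume sub: "flag x \<subseteq> flag y"
  have "face j x = face j y" if "j \<in> D" for j
  proof -
    have "j \<in> R" using that D_subset_R by blast
    then have "face j x \<in> flag y" using sub by (auto simp: flag_def)
    then obtain k where "k \<in> R" "face j x = face k y" by (auto simp: flag_def)
    then show ?thesis using face_eqD[of j x k y] assms \<open>j \<in> R\<close> by auto
  qed
  then show "x = y" using eq_of_faces assms by blast
qed simp

lemma flag_inj: "x \<in> X \<Longrightarrow> y \<in> X \<Longrightarrow> flag x = flag y \<longleftrightarrow> x = y"
  using flag_subset_iff by blast

lemma chain_subset_flag:
  assumes "C \<in> Chains face_order"
  shows "\<exists>x\<in>X. C \<subseteq> flag x"
proof -
  obtain x where x: "x \<in> X" "\<forall>F\<in>C. F = face (rank F) x" using chain_common_flag assms by blast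
  have "rank F \<in> R" if "F \<in> C" for F
  proof -
    have "(F, F) \<in> face_order" using assms that by (auto simp: Chains_def)
    then show ?thesis by (blast elim: face_orderE)
  qed
  then have "C \<subseteq> flag x" using x(2) by (auto simp: flag_def)
  then show ?thesis using x by blast
qed

text \<open>Every chain lies in some \<open>flag x\<close>, and none of these sets properly contains
  another, so they are exactly the maximal chains.\<close>

lemma flags_face_order: "flags face_order = flag ` X"
proof
  show "flags face_order \<subseteq> flag ` X"
  proof
    fix \<Phi> assume \<Phi>: "\<Phi> \<in> flags face_order"
    then obtain x where "x \<in> X" "\<Phi> \<subseteq> flag x"
      using chain_subset_flag[of \<Phi>] by (auto simp: flags_def)
    then show "\<Phi> \<in> flag ` X" using \<Phi> flag_chain by (auto simp: flags_def)
  qed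
  show "flag ` X \<subseteq> flags face_order"
  proof
    fix \<Phi> assume "\<Phi> \<in> flag ` X"
    then obtain x where x: "x \<in> X" "\<Phi> = flag x" by blast
    have "C = flag x" if C: "C \<in> Chains face_order" "flag x \<subseteq> C" for C
    proof -
      obtain y where y: "y \<in> X" "C \<subseteq> flag y" using chain_subset_flag C by blast
      then have "x = y" using flag_subset_iff[of x y] x C by blast
      then show ?thesis using y C by blast
    qed
    then show "\<Phi> \<in> flags face_order" using x flag_chain by (auto simp: flags_def)
  qed
qed

lemma card_flag: "x \<in> X \<Longrightarrow> card (flag x) = d + 2"
proof -
  assume x: "x \<in> X"
  have "inj_on (\<lambda>j. face j x) R" using face_eqD x by (meson inj_onI)
  then show ?thesis by (simp add: flag_def card_image R_def)
qed

lemma flag_minus_act: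
  assumes "i \<in> D" "x \<in> X"
  shows "flag x - flag (act i x) = {face i x}"
proof -
  have iR: "i \<in> R" using assms D_subset_R by blast
  have "face i x \<notin> flag (act i x)"
  proof
    assume "face i x \<in> flag (act i x)"
    then obtain j where "j \<in> R" "face i x = face j (act i x)" by (auto simp: flag_def)
    then show False
      using face_eqD[of i x j "act i x"] face_act_neq assms iR act_closed by metis
  qed
  moreover have "face j x \<in> flag (act i x)" if "j \<in> R" "j \<noteq> i" for j
    using face_act[of i j x] that assms by (metis flag_def image_eqI)
  ultimately show ?thesis using iR by (auto simp: flag_def)
qed

lemma adjacent_at_act:
  assumes "i \<in> D" "x \<in> X"
  shows "adjacent_at face_order rank i (flag x) (flag (act i x))"
proof -
  have "flag (act i x) - flag x = {face i (act i x)}"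
    using flag_minus_act[of i "act i x"] assms act_act act_closed by simp
  moreover have "i \<in> R" using assms D_subset_R by blast
  ultimately show ?thesis
    using flag_minus_act[OF assms] assms act_closed rank_face
    by (auto simp: adjacent_at_def flags_face_order)
qed

lemma adjacent_flagE:
  assumes "adjacent face_order rank (flag x) (flag y)" "x \<in> X" "y \<in> X"
  obtains i where "i \<in> D" "y = act i x"
proof -
  obtain j F G where FG: "flag x - flag y = {F}" "flag y - flag x = {G}" "rank F = j" "rank G = j"
    using assms by (auto simp: adjacent_def adjacent_at_def)
  have eq: "face k x = face k y" if k: "k \<in> R" "k \<noteq> j" for k
  proof (rule ccontr)
    assume ne: "face k x \<noteq> face k y"
    have "face k x \<notin> flag y"
    proof
      assume "face k x \<in> flag y"
      then obtain l where "l \<in> R" "face k x = face l y" by (auto simp: flag_def)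
      then show False using face_eqD[of k x l y] ne k assms by metis
    qed
    then have "face k x = F" using FG(1) k by (auto simp: flag_def)
    then show False using FG(3) rank_face[of k x] k assms(2) by auto
  qed
  \<comment> \<open>All faces except the one of rank j are shared, so the two flags are joined by
    label j alone.\<close>
  have "conn (D - (R - {j})) x y"
    using conn_of_faces[of x y "R - {j}"] eq assms by blast
  then have c: "conn (D \<inter> {j}) x y" by (rule conn_mono) (use D_subset_R in auto)
  have "x \<noteq> y" using FG by auto
  then have "j \<in> D" using c by (cases "j \<in> D") (auto simp: conn_empty)
  moreover from this have "y = act j x" using conn_singleton[of j x y] c \<open>x \<noteq> y\<close> assms by auto
  ultimately show ?thesis using that by blast
qed

text \<open>\<open>conn_of_faces\<close> yields a path that avoids the labels of all shared ranks,
  and such a path never changes a shared face.\<close>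

lemma flags_connected:
  assumes "x \<in> X" "y \<in> X"
  shows "(\<lambda>\<Phi> \<Psi>. adjacent face_order rank \<Phi> \<Psi> \<and> flag x \<inter> flag y \<subseteq> \<Phi> \<and> flag x \<inter> flag y \<subseteq> \<Psi>)\<^sup>*\<^sup>*
          (flag x) (flag y)"
proof -
  define J where "J = {j\<in>R. face j x = face j y}"
  have meet: "flag x \<inter> flag y \<subseteq> flag z" if "z \<in> X" "conn (D - J) x z" for z
  proof
    fix F assume "F \<in> flag x \<inter> flag y"
    then obtain j k where j: "j \<in> R" "k \<in> R" "F = face j x" "face j x = face k y"
      by (auto simp: flag_def)
    then have "j \<in> J" using face_eqD[of j x k y] assms by (auto simp: J_def)
    then have "face j z = face j x" using face_cong[OF that(2)] j assms by blast
    then show "F \<in> flag z" using j by (metis flag_def image_eqI)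
  qed
  have "conn (D - J) x y" by (rule conn_of_faces) (use assms in \<open>auto simp: J_def\<close>)
  define S where "S = flag x \<inter> flag y"
  from \<open>conn (D - J) x y\<close> have "(\<lambda>\<Phi> \<Psi>. adjacent face_order rank \<Phi> \<Psi> \<and> S \<subseteq> \<Phi> \<and> S \<subseteq> \<Psi>)\<^sup>*\<^sup>* (flag x) (flag y)"
  proof (induction rule: conn_induct)
    case (step z i)
    have zX: "z \<in> X" using step(1) by (rule conn_closed) (use assms in auto)
    have "adjacent face_order rank (flag z) (flag (act i z))"
      using adjacent_at_act zX step by (auto simp: adjacent_def)
    moreover have "conn (D - J) x (act i z)" using step conn_trans conn_step by blast
    ultimately show ?case
      using step.IH step.hyps zX act_closed[of i z] meet[of z] meet[of "act i z"]
      by (intro rtranclp.rtrancl_into_rtrancl[OF step.IH]) (auto simp: S_def)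
  qed simp
  then show ?thesis by (simp add: S_def)
qed

section \<open>The diamond condition and the polytope axioms\<close>

lemma chain3:
  assumes "(F, G) \<in> face_order" "(G, H) \<in> face_order"
  obtains z where "z \<in> X" "F = face (rank F) z" "G = face (rank G) z" "H = face (rank H) z"
proof -
  have "{F, G, H} \<in> Chains face_order"
    using assms face_order_trans[OF assms] Partial_order_face_order
    by (auto simp: Chains_def partial_order_on_def preorder_on_def refl_on_def Field_def)
  then show ?thesis using chain_common_flag[of "{F, G, H}"] that by blast
qed

lemma card_between:
  assumes "i \<in> D" "(F, G) \<in> face_order" "rank F = i - 1" "rank G = i + 1"
  shows "card {H. rank H = i \<and> (F, H) \<in> face_order \<and> F \<noteq> H \<and> (H, G) \<in> face_order \<and> H \<noteq> G} = 2"
proof -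
  obtain x where "x \<in> X" "F = face (rank F) x" "G = face (rank G) x"
    using assms(2) by (rule face_orderE)
  then have x: "x \<in> X" "F = face (i - 1) x" "G = face (i + 1) x"
    using assms by simp_all
  have R: "i \<in> R" "i - 1 \<in> R" "i + 1 \<in> R" using assms by (auto simp: D_def R_def)
  have "{H. rank H = i \<and> (F, H) \<in> face_order \<and> F \<noteq> H \<and> (H, G) \<in> face_order \<and> H \<noteq> G}
        = {face i x, face i (act i x)}" (is "?S = _")
  proof
    have in_S: "face i z \<in> ?S" if "z \<in> X" "F = face (i - 1) z" "G = face (i + 1) z" for z
    proof -
      have "rank (face i z) = i" using that R rank_face by blast
      then show ?thesis
        using face_orderI[of "i - 1" i z] face_orderI[of i "i + 1" z] that R assms(3,4) by auto
    qed
    have "face i x \<in> ?S" using x by (intro in_S)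
    moreover have "face i (act i x) \<in> ?S"
      using x R face_act[of i "i-1" x] face_act[of i "i+1" x] assms(1) act_closed
      by (intro in_S) auto
    ultimately show "{face i x, face i (act i x)} \<subseteq> ?S" by blast
    show "?S \<subseteq> {face i x, face i (act i x)}"
    proof
      fix H assume "H \<in> ?S"
      then have H: "(F, H) \<in> face_order" "(H, G) \<in> face_order" "rank H = i" by auto
      obtain z where z: "z \<in> X" "F = face (i - 1) z" "H = face i z" "G = face (i + 1) z"
        using chain3[OF H(1,2)] assms(3,4) H(3) by metis
      have "conn (D - {i - 1, i + 1}) x z"
        by (rule conn_of_faces) (use x z R in auto)
      \<comment> \<open>The labels left besides i are at distance at least 2 from i. The path
        therefore splits into an i-part, with only two possible ends, and a part that fixes the face
        of rank i.\<close>
      moreover have "D - {i - 1, i + 1} = {i} \<union> (D - {i - 1, i, i + 1})" using assms(1) by auto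
      ultimately obtain m where m: "conn {i} x m" "conn (D - {i - 1, i, i + 1}) m z"
        using conn_split[of "{i}" "D - {i - 1, i, i + 1}" x z] assms(1) x(1) by force
      have "m = x \<or> m = act i x" using conn_singleton m(1) assms(1) x(1) by blast
      moreover have "m \<in> X" using calculation x(1) assms(1) act_closed by blast
      then have "H = face i m" using z(3) face_cong[OF m(2), of i] R by auto
      ultimately show "H \<in> {face i x, face i (act i x)}" by blast
    qed
  qed
  moreover have "face i x \<noteq> face i (act i x)" using face_act_neq x(1) assms(1) by metis
  ultimately show ?thesis by simp
qed

lemma abstract_polytope_face_order: "abstract_polytope face_order rank d"
proof
  show "Partial_order face_order" by (rule Partial_order_face_order)
  show "rank F < rank G" if "(F, G) \<in> face_order" "F \<noteq> G" for F G
    using that face_order_antisym_rank face_order_rank[of F G] by force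
  obtain x where x: "x \<in> X" using X_nonempty by blast
  have "R \<subseteq> rank ` Field face_order"
  proof
    fix j assume "j \<in> R"
    then have "rank (face j x) = j" "face j x \<in> Field face_order"
      using rank_face x by (auto simp: Field_face_order)
    then show "j \<in> rank ` Field face_order" by (metis image_eqI)
  qed
  moreover have "rank ` Field face_order \<subseteq> R" by (blast elim: FieldE)
  ultimately show "rank ` Field face_order = {-1..int d}" by (auto simp: R_def)
  have ends: "-1 \<in> R" "int d \<in> R" by (auto simp: R_def)
  have "(face (-1) x, face j y) \<in> face_order" "(face j y, face (int d) x) \<in> face_order"
    if "j \<in> R" "y \<in> X" for j y
    using face_orderI[of "-1" j y] face_orderI[of j "int d" y] face_improper[of _ x y] that ends x
    by (auto simp: R_def)
  then have "(face (-1) x, F) \<in> face_order" "(F, face (int d) x) \<in> face_order"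
    if "F \<in> Field face_order" for F
    using that by (auto simp: Field_face_order)
  moreover have "face (-1) x \<in> Field face_order" "face (int d) x \<in> Field face_order"
    using ends x by (auto simp: Field_face_order)
  ultimately show "\<exists>F\<in>Field face_order. \<forall>G\<in>Field face_order. (F, G) \<in> face_order"
    "\<exists>G\<in>Field face_order. \<forall>F\<in>Field face_order. (F, G) \<in> face_order"
    by blast+
  show "card \<Phi> = d + 2" if "\<Phi> \<in> flags face_order" for \<Phi>
    using that card_flag by (auto simp: flags_face_order)
  show "(\<lambda>X Y. adjacent face_order rank X Y \<and> \<Phi> \<inter> \<Psi> \<subseteq> X \<and> \<Phi> \<inter> \<Psi> \<subseteq> Y)\<^sup>*\<^sup>* \<Phi> \<Psi>"
    if "\<Phi> \<in> flags face_order" "\<Psi> \<in> flags face_order" for \<Phi> \<Psi>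
    using that flags_connected by (auto simp: flags_face_order)
  show "card {H. rank H = i \<and> (F, H) \<in> face_order \<and> F \<noteq> H \<and> (H, G) \<in> face_order \<and> H \<noteq> G} = 2"
    if "0 \<le> i" "i \<le> int d - 1" "(F, G) \<in> face_order" "F \<noteq> G" "rank F = i - 1" "rank G = i + 1"
    for i F G
    using that by (intro card_between) (auto simp: D_def)
qed

end

section \<open>Polygonal sections\<close>

lemma order_isomorphism_inv_into:
  assumes "order_isomorphism s r g"
  shows "order_isomorphism r s (inv_into (Field s) g)"
proof -
  have g: "bij_betw g (Field s) (Field r)"
    and ord: "\<And>a b. a \<in> Field s \<Longrightarrow> b \<in> Field s \<Longrightarrow> (a, b) \<in> s \<longleftrightarrow> (g a, g b) \<in> r"
    using assms by (auto simp: order_isomorphism_def)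
  have inv: "inv_into (Field s) g x \<in> Field s" "g (inv_into (Field s) g x) = x"
    if "x \<in> Field r" for x
    using that g bij_betw_inv_into[OF g] by (auto simp: bij_betw_def f_inv_into_f)
  show ?thesis
    unfolding order_isomorphism_def using bij_betw_inv_into[OF g] ord inv by auto
qed

lemma Field_polygon_lattice: "Field (polygon_lattice k) = polygon_faces k"
  by (auto simp: Field_def polygon_lattice_def)

context flag_system
begin

lemma eq_or_act:
  assumes "x \<in> X" "y \<in> X" "i \<in> D" "\<And>k. k \<in> R \<Longrightarrow> k \<noteq> i \<Longrightarrow> face k x = face k y"
  shows "y = x \<or> y = act i x"
proof -
  have "conn (D - (R - {i})) x y" by (rule conn_of_faces) (use assms in auto)
  moreover have "D - (R - {i}) = {i}" using assms(3) D_subset_R by auto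
  ultimately show ?thesis using conn_singleton assms by auto
qed

text \<open>The labels outside p - 1, ..., p + 2 commute with p and p + 1 and leave the two inner
  faces alone. Hence every flag through the two ends of the section may be replaced by one reached
  from \<open>x\<close> by labels p and p + 1 only.\<close>

lemma section_representative:
  assumes "x \<in> X" "z \<in> X" "p \<in> D" "p + 1 \<in> D"
    "face (p - 1) x = face (p - 1) z" "face (p + 2) x = face (p + 2) z"
  shows "\<exists>m\<in>X. conn {p, p + 1} x m \<and> face p m = face p z \<and> face (p + 1) m = face (p + 1) z"
proof -
  let ?J = "D - {p - 1, p, p + 1, p + 2}"
  have "conn (D - {p - 1, p + 2}) x z"
    by (rule conn_of_faces) (use assms in \<open>auto simp: D_def R_def\<close>)
  moreover have "D - {p - 1, p + 2} = {p, p + 1} \<union> ?J" using assms(3,4) by auto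
  ultimately have "conn ({p, p + 1} \<union> ?J) x z" by metis
  then obtain m where m: "conn {p, p + 1} x m" "conn ?J m z"
    using conn_split[of "{p, p + 1}" ?J x z] assms(1,3,4) by force
  have mX: "m \<in> X" by (rule conn_closed[OF m(1)]) (use assms in auto)
  have "face p z = face p m" "face (p + 1) z = face (p + 1) m"
    by (rule face_cong[OF m(2)]; use mX assms D_subset_R in auto)+
  then show ?thesis using m(1) mX by auto
qed

text \<open>The product of the two involutions rotates the section. The flags \<open>y j\<close>
  obtained by iterating it from one flag supply the vertices and edges in cyclic order, and its
  exact order \<open>k\<close> makes them distinct.\<close>

lemma section_polygon:
  assumes p: "p \<in> D" "p + 1 \<in> D" and k: "0 < k"
    and ord: "\<And>x j. x \<in> X \<Longrightarrow> ((\<lambda>y. act (p + 1) (act p y)) ^^ j) x = x \<longleftrightarrow> k dvd j"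
    and FG: "(F, G) \<in> face_order" "rank F = p - 1" "rank G = p + 2"
  shows "\<exists>f. order_isomorphism (face_section face_order G F) (polygon_lattice k) f"
proof -
  let ?q = "p + 1" and ?\<tau> = "\<lambda>y. act (p + 1) (act p y)"
  have R: "p \<in> R" "p + 1 \<in> R" "p - 1 \<in> R" "p + 2 \<in> R" using p by (auto simp: D_def R_def)
  obtain x where "x \<in> X" "F = face (rank F) x" "G = face (rank G) x"
    using FG(1) by (rule face_orderE)
  then have x: "x \<in> X" "F = face (p - 1) x" "G = face (p + 2) x" using FG by simp_all
  define y where "y j = (?\<tau> ^^ j) x" for j
  have y_0: "y 0 = x" and y_Suc: "y (Suc j) = act ?q (act p (y j))" for j
    by (simp_all add: y_def)
  have yX: "y j \<in> X" for j
    by (induction j) (simp_all add: y_0 y_Suc x act_closed p)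
  \<comment> \<open>A single involution changes parity, so two flags \<open>y i\<close> and
    \<open>y j\<close> sharing a vertex or an edge must be equal: the only other candidate has the
    wrong parity.\<close>
  have par_y: "par (y j) = par x" for j
    by (induction j) (simp_all add: y_0 y_Suc par_act act_closed p yX)
  have face_y: "face i (y j) = face i x" if "i \<in> R" "i \<noteq> p" "i \<noteq> ?q" for i j
    by (induction j) (use that p in \<open>simp_all add: y_0 y_Suc face_act act_closed yX\<close>)
  have y_periodic: "y (j + k) = y j" for j
  proof -
    have "(?\<tau> ^^ k) x = x" using ord[OF x(1), of k] by simp
    then show ?thesis by (simp add: y_def funpow_add)
  qed
  have y_mod: "y (j mod k) = y j" for j
  proof (induction j rule: less_induct)
    case (less j)
    show ?case
    proof (cases "j < k")
      case False
      then have "y (j mod k) = y (j - k)" using less[of "j - k"] k by (simp add: le_mod_geq)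
      then show ?thesis using y_periodic[of "j - k"] False by simp
    qed simp
  qed
  have y_inj_le: "i = j" if "i \<le> j" "j < k" "y i = y j" for i j
  proof -
    have "(?\<tau> ^^ (j - i)) (y i) = (?\<tau> ^^ (j - i + i)) x" unfolding y_def funpow_add by simp
    then have "(?\<tau> ^^ (j - i)) (y i) = y i" using that by (simp add: y_def)
    then have "k dvd j - i" using ord yX by blast
    then show ?thesis using that by (metis diff_is_0_eq dvd_imp_le le_antisym less_imp_diff_less
        linorder_not_le neq0_conv)
  qed
  have y_inj: "i = j" if "i < k" "j < k" "y i = y j" for i j
    using y_inj_le[of i j] y_inj_le[of j i] that by (cases "i \<le> j") auto
  have vertex_Suc: "face p (y (Suc j)) = face p (act p (y j))" for j
    unfolding y_Suc using face_act p R act_closed yX by simp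
  have edge_act: "face ?q (act p (y j)) = face ?q (y j)" for j
    using face_act p R yX by simp
  have vertex_inj: "i = j" if "face p (y i) = face p (y j)" "i < k" "j < k" for i j
  proof -
    have "y j = y i \<or> y j = act ?q (y i)"
      by (rule eq_or_act; use face_y yX p that in metis)
    then have "y j = y i" using par_y par_act[of ?q "y i"] p yX by metis
    then show ?thesis using y_inj that by metis
  qed
  have edge_inj: "i = j" if "face ?q (y i) = face ?q (y j)" "i < k" "j < k" for i j
  proof -
    have "y j = y i \<or> y j = act p (y i)"
      by (rule eq_or_act; use face_y yX p that in metis)
    then have "y j = y i" using par_y par_act[of p "y i"] p yX by metis
    then show ?thesis using y_inj that by metis
  qed
  have dihedral: "\<exists>j. m = y j \<or> m = act p (y j)" if "conn {p, ?q} x m" for m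
    using that
  proof (induction rule: conn_induct)
    case refl
    then show ?case using y_0 by metis
  next
    case (step m i)
    then obtain j where j: "m = y j \<or> m = act p (y j)" by blast
    \<comment> \<open>The predecessor of \<open>y j\<close> carries the index
      \<open>j + k - 1\<close>, because \<open>j - 1\<close> would be truncated at 0.\<close>
    have "act ?q (y j) = act p (y (j + k - 1))"
    proof -
      have "y j = act ?q (act p (y (j + k - 1)))"
        using y_Suc[of "j + k - 1"] y_periodic[of j] k by simp
      then show ?thesis using act_act act_closed p yX by metis
    qed
    moreover have "act p (act p (y j)) = y j" using act_act p yX by simp
    ultimately show ?case using j step y_Suc[of j] by (metis insertE singletonD)
  qed
  have locate: "\<exists>m\<in>X. (\<forall>i\<in>R. i \<noteq> p \<longrightarrow> i \<noteq> ?q \<longrightarrow> face i m = face i x) \<and>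
      conn {p, ?q} x m \<and> face p m = face p z \<and> face ?q m = face ?q z"
    if z: "z \<in> X" "F = face (p - 1) z" "G = face (p + 2) z" for z
  proof -
    obtain m where m: "m \<in> X" "conn {p, ?q} x m" "face p m = face p z" "face ?q m = face ?q z"
      using section_representative[of x z p] x z p by auto
    moreover have "face i m = face i x" if "i \<in> R" "i \<noteq> p" "i \<noteq> ?q" for i
      by (rule face_cong[OF m(2)]) (use that p x in auto)
    ultimately show ?thesis by blast
  qed
  have refl: "(H, H) \<in> face_order" if "H \<in> Field face_order" for H
    using that Partial_order_face_order
    by (auto simp: partial_order_on_def preorder_on_def refl_on_def)
  have ranks: "rank (face p (y j)) = p" "rank (face ?q (y j)) = ?q" for j
    using rank_face R yX by auto
  have incident_iff: "(face p (y i), face ?q (y j)) \<in> face_order \<longleftrightarrow> i = j \<or> i = (j + 1) mod k"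
    if "i < k" "j < k" for i j
  proof
    assume inc: "(face p (y i), face ?q (y j)) \<in> face_order"
    have FV: "(F, face p (y i)) \<in> face_order" and EG: "(face ?q (y j), G) \<in> face_order"
      using face_orderI[of "p - 1" p "y i"] face_orderI[of ?q "p + 2" "y j"] R yX x face_y p by auto
    have "(F, face ?q (y j)) \<in> face_order" "(face p (y i), G) \<in> face_order"
      using face_order_trans[OF FV inc] face_order_trans[OF inc EG] .
    moreover have "(H, H) \<in> face_order" if "H \<in> {F, face p (y i), face ?q (y j), G}" for H
      using that inc FG(1) refl by (auto simp: Field_def)
    ultimately have "{F, face p (y i), face ?q (y j), G} \<in> Chains face_order"
      using inc FG(1) FV EG by (simp add: Chains_def)
    then obtain z where z: "z \<in> X" "\<forall>H\<in>{F, face p (y i), face ?q (y j), G}. H = face (rank H) z"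
      using chain_common_flag by blast
    have "F = face (p - 1) z" "G = face (p + 2) z" using z(2) FG(2,3) by auto
    then obtain m where m: "m \<in> X" "\<And>l. l \<in> R \<Longrightarrow> l \<noteq> p \<Longrightarrow> l \<noteq> ?q \<Longrightarrow> face l m = face l x"
      "face p m = face p z" "face ?q m = face ?q z"
      using locate[OF z(1)] by blast
    have mV: "face p m = face p (y i)" and mE: "face ?q m = face ?q (y j)"
      using m z(2) ranks by auto
    \<comment> \<open>\<open>m\<close> has the vertex of \<open>y i\<close> and the edge of
      \<open>y j\<close>. Parity excludes the mixed cases, so either the two flags agree, or
      \<open>m\<close> joins edge j to the vertex of its successor.\<close>
    have "m = y i \<or> m = act ?q (y i)"
      by (rule eq_or_act; use mV m(1,2) face_y yX p in metis)
    moreover have "m = y j \<or> m = act p (y j)"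
      by (rule eq_or_act; use mE m(1,2) face_y yX p in metis)
    moreover have "par (act p (y j)) = (\<not> par x)" "par (act ?q (y i)) = (\<not> par x)"
      using par_act par_y yX p by auto
    ultimately have "y i = y j \<or> act ?q (y i) = act p (y j)" using par_y by metis
    then show "i = j \<or> i = (j + 1) mod k"
    proof
      assume "y i = y j"
      then show ?thesis using y_inj that by blast
    next
      assume "act ?q (y i) = act p (y j)"
      then have "y i = y (Suc j)" using act_act p yX y_Suc by metis
      then have "y i = y ((j + 1) mod k)" using y_mod[of "j + 1"] by simp
      then show ?thesis using y_inj[of i "(j + 1) mod k"] that k by simp
    qed
  next
    assume "i = j \<or> i = (j + 1) mod k"
    then show "(face p (y i), face ?q (y j)) \<in> face_order"
    proof
      assume "i = j"
      then show ?thesis using face_orderI R yX by auto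
    next
      assume "i = (j + 1) mod k"
      then have "y i = y (Suc j)" using y_mod[of "j + 1"] by simp
      then show ?thesis
        using face_orderI[of p ?q "act p (y j)"] vertex_Suc edge_act R yX act_closed p by auto
    qed
  qed
  let ?A = "{H. (F, H) \<in> face_order \<and> (H, G) \<in> face_order}"
  let ?S = "face_section face_order G F"
  have A_Field: "?A \<subseteq> Field face_order" by (auto simp: Field_def)
  have S_iff: "(H, K) \<in> ?S \<longleftrightarrow> (H, K) \<in> face_order" if "H \<in> ?A" "K \<in> ?A" for H K
    using that by (auto simp: face_section_def)
  have Field_S: "Field ?S = ?A"
  proof
    show "Field ?S \<subseteq> ?A" by (auto simp: face_section_def Field_def)
    show "?A \<subseteq> Field ?S"
    proof
      fix H assume "H \<in> ?A"
      then have "(H, H) \<in> ?S" using S_iff refl A_Field by blast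
      then show "H \<in> Field ?S" by (rule FieldI1)
    qed
  qed
  define g where "g a = (case a of Empty_Face \<Rightarrow> F | Vertex j \<Rightarrow> face p (y j)
      | Edge j \<Rightarrow> face ?q (y j) | Whole_Polygon \<Rightarrow> G)" for a
  have g_simps: "g Empty_Face = F" "g (Vertex j) = face p (y j)" "g (Edge j) = face ?q (y j)"
    "g Whole_Polygon = G" for j
    by (simp_all add: g_def)
  have rank_g: "rank (g Empty_Face) = p - 1" "rank (g (Vertex j)) = p" "rank (g (Edge j)) = ?q"
    "rank (g Whole_Polygon) = p + 2" for j
    using FG ranks by (simp_all add: g_simps)
  have FA: "F \<in> ?A" and GA: "G \<in> ?A" using FG(1) refl by (auto simp: Field_def)
  have VE_A: "face p (y j) \<in> ?A" "face ?q (y j) \<in> ?A" for j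
    using face_orderI[of "p - 1" p "y j"] face_orderI[of p "p + 2" "y j"]
      face_orderI[of "p - 1" ?q "y j"] face_orderI[of ?q "p + 2" "y j"] R yX x face_y p by auto
  have gA: "g a \<in> ?A" for a using FA GA VE_A by (cases a) (simp_all add: g_simps)
  have g_inj: "inj_on g (polygon_faces k)"
  proof (rule inj_onI)
    fix a b assume ab: "a \<in> polygon_faces k" "b \<in> polygon_faces k" "g a = g b"
    then have "rank (g a) = rank (g b)" by simp
    then show "a = b"
      using ab vertex_inj edge_inj
      by (cases a; cases b) (auto simp: rank_g, auto simp: g_simps polygon_faces_def)
  qed
  have g_surj: "H \<in> g ` polygon_faces k" if H: "H \<in> ?A" for H
  proof -
    have FH: "(F, H) \<in> face_order" "(H, G) \<in> face_order" using H by auto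
    obtain z where z: "z \<in> X" "F = face (p - 1) z" "H = face (rank H) z" "G = face (p + 2) z"
      using chain3[OF FH] FG(2,3) by metis
    have rH: "p - 1 \<le> rank H" "rank H \<le> p + 2" using FH face_order_rank FG(2,3) by metis+
    obtain m where m: "m \<in> X" "conn {p, ?q} x m" "face p m = face p z" "face ?q m = face ?q z"
      using locate z by blast
    obtain j where j: "m = y j \<or> m = act p (y j)" using dihedral m(2) by blast
    have in_range: "Vertex (l mod k) \<in> polygon_faces k" "Edge (l mod k) \<in> polygon_faces k"
      "Empty_Face \<in> polygon_faces k" "Whole_Polygon \<in> polygon_faces k" for l
      using k by (auto simp: polygon_faces_def)
    have "\<exists>l. face p m = face p (y l)" using j vertex_Suc by metis
    then have V: "face p m \<in> g ` polygon_faces k"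
      using in_range(1) y_mod g_simps(2) by (metis image_eqI)
    have "\<exists>l. face ?q m = face ?q (y l)" using j edge_act by metis
    then have E: "face ?q m \<in> g ` polygon_faces k"
      using in_range(2) y_mod g_simps(3) by (metis image_eqI)
    consider "rank H = p - 1" | "rank H = p" | "rank H = ?q" | "rank H = p + 2"
      using rH by linarith
    then show ?thesis
    proof cases
      case 1
      then show ?thesis using z in_range(3) g_simps(1) by (metis image_eqI)
    next
      case 2
      then show ?thesis using z m V by metis
    next
      case 3
      then show ?thesis using z m E by metis
    next
      case 4
      then show ?thesis using z in_range(4) g_simps(4) by (metis image_eqI)
    qed
  qed
  have "bij_betw g (polygon_faces k) ?A"
    using g_inj g_surj gA unfolding bij_betw_def by blast
  moreover have "(a, b) \<in> polygon_lattice k \<longleftrightarrow> (g a, g b) \<in> face_order"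
    if ab: "a \<in> polygon_faces k" "b \<in> polygon_faces k" for a b
  proof -
    have le: "rank (g a) \<le> rank (g b)" if "(g a, g b) \<in> face_order"
      using that by (rule face_order_rank)
    have eq: "a = b" if "(g a, g b) \<in> face_order" "rank (g a) = rank (g b)"
      using face_order_antisym_rank[OF that] g_inj ab by (auto dest: inj_onD)
    have rf: "(g a, g a) \<in> face_order" using gA[of a] refl A_Field by blast
    have bot: "(F, g b) \<in> face_order" and top: "(g a, G) \<in> face_order" using gA by auto
    show ?thesis
    \<comment> \<open>If the rank does not increase, both orders reduce to equality; otherwise only
      the incidence of a vertex with an edge is not automatic.\<close>
    proof (cases "rank (g b) \<le> rank (g a)")
      case True
      then have "(g a, g b) \<in> face_order \<longleftrightarrow> a = b" using le eq rf by force
      moreover have "(a, b) \<in> polygon_lattice k \<longleftrightarrow> a = b"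
        using True ab by (cases a; cases b) (auto simp: rank_g polygon_lattice_def)
      ultimately show ?thesis by simp
    next
      case False
      then show ?thesis
        using ab bot top incident_iff
        by (cases a; cases b) (auto simp: FG ranks polygon_lattice_def g_simps polygon_faces_def)
    qed
  qed
  ultimately have "order_isomorphism (polygon_lattice k) ?S g"
    using gA S_iff by (simp add: order_isomorphism_def Field_S Field_polygon_lattice)
  then show ?thesis using order_isomorphism_inv_into by blast
qed

end

section \<open>Symmetries and automorphisms\<close>

context flag_graph
begin

definition symmetry :: "('x \<Rightarrow> 'x) \<Rightarrow> bool" where
  "symmetry \<phi> \<longleftrightarrow> (\<forall>x\<in>X. \<phi> x \<in> X) \<and> (\<forall>i\<in>D. \<forall>x\<in>X. \<phi> (act i x) = act i (\<phi> x))"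

lemma symmetry_closed: "symmetry \<phi> \<Longrightarrow> x \<in> X \<Longrightarrow> \<phi> x \<in> X"
  by (simp add: symmetry_def)

lemma symmetry_act: "symmetry \<phi> \<Longrightarrow> i \<in> D \<Longrightarrow> x \<in> X \<Longrightarrow> \<phi> (act i x) = act i (\<phi> x)"
  by (simp add: symmetry_def)

lemma symmetry_comp: "symmetry \<phi> \<Longrightarrow> symmetry \<psi> \<Longrightarrow> symmetry (\<lambda>x. \<phi> (\<psi> x))"
  by (simp add: symmetry_def)

lemma symmetry_id: "symmetry (\<lambda>x. x)"
  by (simp add: symmetry_def)

lemma symmetry_conn:
  assumes "symmetry \<phi>" "I \<subseteq> D" "x \<in> X" "conn I x y"
  shows "conn I (\<phi> x) (\<phi> y)"
  using assms(4)
proof (induction rule: conn_induct)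
  case (step y i)
  have "y \<in> X" using step.hyps(1) assms(2,3) by (rule conn_closed)
  then have "\<phi> (act i y) = act i (\<phi> y)" using symmetry_act assms step.hyps by blast
  then show ?case using conn_trans[OF step.IH] conn_step step.hyps by metis
qed simp

text \<open>Commuting with all \<open>act i\<close> determines a symmetry along every path from one
  flag; this is why the group acts freely on flags.\<close>

lemma symmetry_unique:
  assumes "symmetry \<phi>" "symmetry \<psi>" "x \<in> X" "\<phi> x = \<psi> x" "y \<in> X"
  shows "\<phi> y = \<psi> y"
  using connected[OF assms(3,5)]
proof (induction rule: conn_induct)
  case refl
  show ?case by (rule assms)
next
  case (step y i)
  have "y \<in> X" using step.hyps(1) by (rule conn_closed) (use assms in auto)
  then show ?case using step assms symmetry_act by metis
qed

text \<open>Each step flips the parity of a flag and of its image alike, so a symmetry preserves all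
  parities or reverses all of them.\<close>

lemma symmetry_par:
  assumes "symmetry \<phi>" "x \<in> X" "y \<in> X"
  shows "(par (\<phi> y) = par y) = (par (\<phi> x) = par x)"
  using connected[OF assms(2,3)]
proof (induction rule: conn_induct)
  case (step y i)
  have yX: "y \<in> X" using step.hyps(1) by (rule conn_closed) (use assms in auto)
  have "par (\<phi> (act i y)) = (\<not> par (\<phi> y))"
    using symmetry_act[of \<phi> i y] par_act[of i "\<phi> y"] step.hyps(2) assms(1) yX symmetry_closed
    by simp
  then show ?case using par_act step yX by auto
qed simp

text \<open>The image is closed under every \<open>act i\<close>, hence is all of \<open>X\<close>
  by connectedness; finiteness then gives injectivity.\<close>

lemma symmetry_inverse:
  assumes "finite X" "symmetry \<phi>"
  shows "\<exists>\<psi>. symmetry \<psi> \<and> (\<forall>x\<in>X. \<psi> (\<phi> x) = x \<and> \<phi> (\<psi> x) = x)"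
proof -
  obtain b where b: "b \<in> X" using X_nonempty by blast
  have "y \<in> \<phi> ` X" if "y \<in> X" for y
    using connected[OF symmetry_closed[OF assms(2) b] that]
  proof (induction rule: conn_induct)
    case (step y i)
    then obtain x where "x \<in> X" "y = \<phi> x" by blast
    then show ?case using symmetry_act[OF assms(2)] act_closed step.hyps by (metis image_eqI)
  qed (use b in blast)
  then have img: "\<phi> ` X = X" using symmetry_closed assms(2) by blast
  then have inj: "inj_on \<phi> X" using assms(1) by (simp add: eq_card_imp_inj_on)
  define \<psi> where "\<psi> = inv_into X \<phi>"
  have \<psi>: "\<psi> (\<phi> x) = x" "\<phi> (\<psi> x) = x" "\<psi> x \<in> X" if "x \<in> X" for x
    using that inj img by (auto simp: \<psi>_def f_inv_into_f inv_into_into)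
  have "\<psi> (act i x) = act i (\<psi> x)" if "i \<in> D" "x \<in> X" for i x
    using \<psi> that symmetry_act[OF assms(2)] act_closed by metis
  then have "symmetry \<psi>" using \<psi>(3) by (simp add: symmetry_def)
  then show ?thesis using \<psi> by blast
qed

text \<open>The flags of the same parity as \<open>b\<close> are reached from \<open>b\<close> by words in the
  products \<open>act l \<circ> act i\<close> and their inverses.\<close>

lemma symmetry_transitive:
  assumes fin: "finite X" and l: "l \<in> D" and b: "b \<in> X"
    and gen: "\<And>i. i \<in> D \<Longrightarrow> \<exists>\<phi>. symmetry \<phi> \<and> \<phi> b = act l (act i b)"
    and x: "x \<in> X" "y \<in> X" "par x = par y"
  shows "\<exists>\<phi>. symmetry \<phi> \<and> \<phi> x = y"
proof -
  \<comment> \<open>A flag of the wrong parity is represented by its neighbour under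
    \<open>act l\<close>, so the induction can run over single steps.\<close>
  have reach: "\<exists>\<phi>. symmetry \<phi> \<and> \<phi> b = (if par z = par b then z else act l z)" if "z \<in> X" for z
    using connected[OF b that]
  proof (induction rule: conn_induct)
    case refl
    show ?case using symmetry_id by auto
  next
    case (step z i)
    have zX: "z \<in> X" using step.hyps(1) by (rule conn_closed) (use b in auto)
    obtain \<phi> where \<phi>: "symmetry \<phi>" "\<phi> b = (if par z = par b then z else act l z)"
      using step.IH by blast
    have par_i: "par (act i z) \<longleftrightarrow> \<not> par z" using par_act step.hyps zX by blast
    obtain \<psi> where \<psi>: "symmetry \<psi>" "\<psi> b = act l (act i b)" using gen step.hyps by blast
    obtain \<psi>' where \<psi>': "symmetry \<psi>'" "\<forall>x\<in>X. \<psi>' (\<psi> x) = x"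
      using symmetry_inverse[OF fin \<psi>(1)] by blast
    show ?case
    proof (cases "par z = par b")
      case True
      then have "\<phi> (\<psi> b) = act l (act i z)"
        using \<phi>(2) \<psi>(2) symmetry_act[OF \<phi>(1)] b act_closed l step.hyps by metis
      then show ?thesis using symmetry_comp[OF \<phi>(1) \<psi>(1)] True par_i by auto
    next
      case False
      then have z: "z = \<phi> (act l b)"
        using \<phi>(2) symmetry_act[OF \<phi>(1) l b] act_act[OF l zX] by simp
      have "\<psi> (act i (act l b)) = b"
        using \<psi> symmetry_act[OF \<psi>(1)] act_act act_closed l b step.hyps by metis
      \<comment> \<open>Leaving a flag of the wrong parity uses the factors in the opposite order,
        which is what the inverse of the generator provides.\<close>
      then have "\<psi>' b = act i (act l b)" using \<psi>'(2) act_closed l b step.hyps by metis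
      then have "\<phi> (\<psi>' b) = act i z"
        using z symmetry_act[OF \<phi>(1)] act_closed l b step.hyps by metis
      then show ?thesis using symmetry_comp[OF \<phi>(1) \<psi>'(1)] False par_i by auto
    qed
  qed
  obtain \<phi> where \<phi>: "symmetry \<phi>" "\<phi> b = (if par x = par b then x else act l x)"
    using reach x by blast
  obtain \<phi>' where \<phi>': "symmetry \<phi>'" "\<forall>w\<in>X. \<phi>' (\<phi> w) = w"
    using symmetry_inverse[OF fin \<phi>(1)] by blast
  obtain \<psi> where \<psi>: "symmetry \<psi>" "\<psi> b = (if par x = par b then y else act l y)"
    using reach[of y] x by auto
  have "\<psi> (\<phi>' x) = y"
  proof (cases "par x = par b")
    case True
    then show ?thesis using \<phi>(2) \<phi>'(2) \<psi>(2) b by metis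
  next
    case False
    then have "\<phi>' (act l x) = b" using \<phi>(2) \<phi>'(2) b by metis
    then have "act l (\<phi>' x) = b" using symmetry_act[OF \<phi>'(1) l x(1)] by simp
    then have "\<phi>' x = act l b" using act_act[OF l symmetry_closed[OF \<phi>'(1) x(1)]] by simp
    then have "\<psi> (\<phi>' x) = act l (act l y)"
      using symmetry_act[OF \<psi>(1) l b] \<psi>(2) False by simp
    then show ?thesis using act_act[OF l x(2)] by simp
  qed
  then show ?thesis using symmetry_comp[OF \<psi>(1) \<phi>'(1)] by blast
qed

end

section \<open>Automorphisms of the face poset correspond to symmetries\<close>

context flag_system
begin

text \<open>The restriction to \<open>Field face_order\<close> gives the extensionality required by
  \<open>automorphism_group\<close>; the chosen flag does not affect the value, by
  \<open>face_map_face\<close>.\<close>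

definition face_map :: "('x \<Rightarrow> 'x) \<Rightarrow> 'f \<Rightarrow> 'f" where
  "face_map \<phi> = (\<lambda>F\<in>Field face_order. face (rank F) (\<phi> (SOME x. x \<in> X \<and> F = face (rank F) x)))"

lemma face_in_Field: "j \<in> R \<Longrightarrow> x \<in> X \<Longrightarrow> face j x \<in> Field face_order"
  by (auto simp: Field_face_order)

lemma face_map_face:
  assumes "symmetry \<phi>" "j \<in> R" "x \<in> X"
  shows "face_map \<phi> (face j x) = face j (\<phi> x)"
proof -
  define y where "y = (SOME y. y \<in> X \<and> face j x = face j y)"
  have y: "y \<in> X" "face j x = face j y"
    unfolding y_def by (rule someI2[of _ x]; use assms in simp)+
  have "conn (D - {j}) x y" using face_eqD y assms by blast
  then have "conn (D - {j}) (\<phi> x) (\<phi> y)" using symmetry_conn assms(1,3) by blast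
  then have "face j (\<phi> y) = face j (\<phi> x)"
    by (rule face_cong) (use assms symmetry_closed in auto)
  then show ?thesis
    using assms face_in_Field by (simp add: face_map_def rank_face y_def)
qed

lemma face_map_automorphism:
  assumes "finite X" "symmetry \<phi>"
  shows "face_map \<phi> \<in> carrier (automorphism_group face_order)"
proof -
  obtain \<psi> where \<psi>: "symmetry \<psi>" "\<And>x. x \<in> X \<Longrightarrow> \<psi> (\<phi> x) = x" "\<And>x. x \<in> X \<Longrightarrow> \<phi> (\<psi> x) = x"
    using symmetry_inverse assms by blast
  have closed: "face_map \<chi> F \<in> Field face_order" if "symmetry \<chi>" "F \<in> Field face_order" for \<chi> F
    using that symmetry_closed face_in_Field by (auto simp: Field_face_order face_map_face)
  have inv: "face_map \<psi> (face_map \<phi> F) = F" "face_map \<phi> (face_map \<psi> F) = F"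
    if "F \<in> Field face_order" for F
    using that assms(2) \<psi> symmetry_closed by (auto simp: Field_face_order face_map_face)
  have bij: "bij_betw (face_map \<phi>) (Field face_order) (Field face_order)"
    by (rule bij_betw_byWitness[where f' = "face_map \<psi>"]) (use inv closed assms(2) \<psi>(1) in auto)
  have mono: "(face_map \<chi> F, face_map \<chi> G) \<in> face_order"
    if "symmetry \<chi>" "(F, G) \<in> face_order" for \<chi> F G
    using that symmetry_closed by (auto simp: face_order_def face_map_face) blast
  have "(F, G) \<in> face_order \<longleftrightarrow> (face_map \<phi> F, face_map \<phi> G) \<in> face_order"
    if "F \<in> Field face_order" "G \<in> Field face_order" for F G
    using mono[OF assms(2), of F G] mono[OF \<psi>(1), of "face_map \<phi> F" "face_map \<phi> G"] inv that by auto
  then have "order_isomorphism face_order face_order (face_map \<phi>)"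
    using bij by (simp add: order_isomorphism_def)
  moreover have "face_map \<phi> \<in> extensional (Field face_order)"
    by (simp add: face_map_def)
  ultimately show ?thesis using bij by (simp add: automorphism_group_def Bij_def)
qed

lemma automorphismD:
  assumes "f \<in> carrier (automorphism_group face_order)"
  shows "f \<in> extensional (Field face_order)" "bij_betw f (Field face_order) (Field face_order)"
    and "F \<in> Field face_order \<Longrightarrow> G \<in> Field face_order \<Longrightarrow>
      (F, G) \<in> face_order \<longleftrightarrow> (f F, f G) \<in> face_order"
  using assms by (auto simp: automorphism_group_def Bij_def order_isomorphism_def)

text \<open>Along a flag the ranks of the images form a strictly increasing map of the finite
  interval \<open>R\<close> into itself, which squeezes it to the identity from both ends.\<close>

lemma rank_automorphism:
  assumes f: "f \<in> carrier (automorphism_group face_order)" and x: "x \<in> X" and j: "j \<in> R"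
  shows "rank (f (face j x)) = j"
proof -
  define h where "h j = rank (f (face j x))" for j
  have f_Field: "f (face j x) \<in> Field face_order" if "j \<in> R" for j
    using automorphismD(2)[OF f] face_in_Field[OF that x] by (auto simp: bij_betw_def)
  have hR: "h j \<in> R" if "j \<in> R" for j
    using f_Field[OF that] unfolding h_def by (rule FieldE)
  have step: "h j < h (j + 1)" if "j \<in> R" "j + 1 \<in> R" for j
  proof -
    have le: "(f (face j x), f (face (j + 1) x)) \<in> face_order"
      using automorphismD(3)[OF f] face_orderI[of j "j + 1" x] face_in_Field that x by simp
    have "face j x \<noteq> face (j + 1) x" using face_eqD that x by fastforce
    then have "f (face j x) \<noteq> f (face (j + 1) x)"
      using automorphismD(2)[OF f] face_in_Field that x by (metis bij_betw_def inj_onD)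
    then show ?thesis
      using face_order_rank[OF le] face_order_antisym_rank[OF le] by (force simp: h_def)
  qed
  have lower: "-1 \<le> j \<Longrightarrow> j \<in> R \<longrightarrow> j \<le> h j" for j
  proof (induction j rule: int_ge_induct)
    case (step i)
    then show ?case using \<open>i \<in> R \<Longrightarrow> i + 1 \<in> R \<Longrightarrow> h i < h (i + 1)\<close> by (auto simp: R_def)
  qed (use hR in \<open>auto simp: R_def\<close>)
  have upper: "j \<le> int d \<Longrightarrow> j \<in> R \<longrightarrow> h j \<le> j" for j
  proof (induction j rule: int_le_induct)
    case (step i)
    then show ?case
      using \<open>i - 1 \<in> R \<Longrightarrow> i - 1 + 1 \<in> R \<Longrightarrow> h (i - 1) < h (i - 1 + 1)\<close> by (auto simp: R_def)
  qed (use hR in \<open>auto simp: R_def\<close>)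
  show ?thesis using lower[of j] upper[of j] j by (auto simp: h_def R_def)
qed

lemma automorphism_symmetry:
  assumes f: "f \<in> carrier (automorphism_group face_order)"
  shows "\<exists>\<phi>. symmetry \<phi> \<and> (\<forall>x\<in>X. \<forall>j\<in>R. f (face j x) = face j (\<phi> x))"
proof -
  have "\<exists>y\<in>X. \<forall>j\<in>R. f (face j x) = face j y" if x: "x \<in> X" for x
  proof -
    have "f ` flag x \<in> Chains face_order"
      using flag_chain[OF x] automorphismD(3)[OF f] face_in_Field x
      by (auto simp: Chains_def flag_def)
    then obtain y where "y \<in> X" "\<forall>F\<in>f ` flag x. F = face (rank F) y"
      using chain_common_flag by blast
    then show ?thesis using rank_automorphism[OF f x] by (auto simp: flag_def)
  qed
  then obtain \<phi> where \<phi>: "\<And>x. x \<in> X \<Longrightarrow> \<phi> x \<in> X"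
      "\<And>x j. x \<in> X \<Longrightarrow> j \<in> R \<Longrightarrow> f (face j x) = face j (\<phi> x)"
    by metis
  have inj: "x = y" if "x \<in> X" "y \<in> X" "\<phi> x = \<phi> y" for x y
  proof (rule eq_of_faces)
    fix j assume "j \<in> D"
    then have jR: "j \<in> R" using D_subset_R by blast
    then have "f (face j x) = f (face j y)" using \<phi>(2) that by simp
    then show "face j x = face j y"
      using automorphismD(2)[OF f] face_in_Field jR that by (metis bij_betw_def inj_onD)
  qed (use that in auto)
  have "\<phi> (act i x) = act i (\<phi> x)" if i: "i \<in> D" and x: "x \<in> X" for i x
  proof -
    have "face k (\<phi> x) = face k (\<phi> (act i x))" if "k \<in> R" "k \<noteq> i" for k
      using \<phi>(2)[OF x that(1)] \<phi>(2)[OF act_closed[OF i x] that(1)] face_act[of i k x] that i x by simp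
    \<comment> \<open>All faces except possibly the one of rank i agree, which leaves two
      candidates; injectivity excludes the first.\<close>
    then have "\<phi> (act i x) = \<phi> x \<or> \<phi> (act i x) = act i (\<phi> x)"
      by (intro eq_or_act) (use \<phi>(1) act_closed i x in auto)
    then show ?thesis using inj[of "act i x" x] act_neq act_closed i x by blast
  qed
  then have "symmetry \<phi>" using \<phi>(1) by (simp add: symmetry_def)
  then show ?thesis using \<phi>(2) by blast
qed

lemma image_flag:
  assumes "\<And>j. j \<in> R \<Longrightarrow> f (face j x) = face j y"
  shows "f ` flag x = flag y"
  using assms by (simp add: flag_def image_image)

end

text \<open>Transitivity on each parity class together with invariance of parity makes the two
  parity classes the flag orbits, and adjacent flags have opposite parity.\<close>

locale chiral_flag_system = flag_system +
  assumes finite_X: "finite X"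
    and d_pos: "0 < d"
    and transitive: "x \<in> X \<Longrightarrow> y \<in> X \<Longrightarrow> par x = par y \<Longrightarrow> \<exists>\<phi>. symmetry \<phi> \<and> \<phi> x = y"
    and symmetry_par_eq: "symmetry \<phi> \<Longrightarrow> x \<in> X \<Longrightarrow> par (\<phi> x) = par x"
begin

lemma orbit_flag:
  assumes "x \<in> X"
  shows "orbit (automorphism_group face_order) (flag_action face_order) (flag x)
       = flag ` {y \<in> X. par y = par x}"
proof
  have x: "flag x \<in> flags face_order" using assms by (simp add: flags_face_order)
  show "orbit (automorphism_group face_order) (flag_action face_order) (flag x)
       \<subseteq> flag ` {y \<in> X. par y = par x}"
  proof
    fix \<Phi> assume "\<Phi> \<in> orbit (automorphism_group face_order) (flag_action face_order) (flag x)"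
    then obtain f where f: "f \<in> carrier (automorphism_group face_order)" "\<Phi> = f ` flag x"
      using x by (auto simp: orbit_def flag_action_def)
    obtain \<phi> where \<phi>: "symmetry \<phi>" "\<forall>x\<in>X. \<forall>j\<in>R. f (face j x) = face j (\<phi> x)"
      using automorphism_symmetry f(1) by blast
    then have "\<Phi> = flag (\<phi> x)" using image_flag[of f x "\<phi> x"] f(2) assms by simp
    then show "\<Phi> \<in> flag ` {y \<in> X. par y = par x}"
      using \<phi>(1) symmetry_closed symmetry_par_eq assms by blast
  qed
  show "flag ` {y \<in> X. par y = par x}
       \<subseteq> orbit (automorphism_group face_order) (flag_action face_order) (flag x)"
  proof
    fix \<Phi> assume "\<Phi> \<in> flag ` {y \<in> X. par y = par x}"
    then obtain y where y: "y \<in> X" "par y = par x" "\<Phi> = flag y" by blast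
    then obtain \<phi> where \<phi>: "symmetry \<phi>" "\<phi> x = y" using transitive[of x y] assms by auto
    then have "face_map \<phi> ` flag x = flag y"
      by (intro image_flag) (simp add: face_map_face assms)
    then show "\<Phi> \<in> orbit (automorphism_group face_order) (flag_action face_order) (flag x)"
      using face_map_automorphism[OF finite_X \<phi>(1)] x y(3)
      by (auto simp: orbit_def flag_action_def)
  qed
qed

lemma orbit_flag_neq:
  assumes "x \<in> X" "y \<in> X" "par x \<noteq> par y"
  shows "orbit (automorphism_group face_order) (flag_action face_order) (flag x)
       \<noteq> orbit (automorphism_group face_order) (flag_action face_order) (flag y)"
proof -
  have "flag x \<in> flag ` {z \<in> X. par z = par x}" using assms by blast
  moreover have "flag x \<notin> flag ` {z \<in> X. par z = par y}" using assms flag_inj by auto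
  ultimately show ?thesis using orbit_flag assms by metis
qed

lemma chiral_polytope_face_order: "chiral_polytope face_order rank d"
proof -
  interpret abstract_polytope face_order rank d by (rule abstract_polytope_face_order)
  let ?orb = "orbit (automorphism_group face_order) (flag_action face_order)"
  show ?thesis
  proof
    obtain x where x: "x \<in> X" using X_nonempty by blast
    have D0: "0 \<in> D" using d_pos by (simp add: D_def)
    let ?y = "act 0 x"
    have y: "?y \<in> X" "par ?y \<noteq> par x" using act_closed par_act D0 x by auto
    have "orbits (automorphism_group face_order) (flags face_order) (flag_action face_order)
        = {?orb (flag x), ?orb (flag ?y)}"
    proof -
      have "?orb (flag z) = ?orb (flag x) \<or> ?orb (flag z) = ?orb (flag ?y)" if "z \<in> X" for z
      proof (cases "par z = par x")
        case True
        then show ?thesis using orbit_flag[OF that] orbit_flag[OF x] by simp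
      next
        case False
        then have "par z = par ?y" using y(2) by simp
        then show ?thesis using orbit_flag[OF that] orbit_flag[OF y(1)] by simp
      qed
      then show ?thesis using x y by (auto simp: orbits_def flags_face_order)
    qed
    then show "card (orbits (automorphism_group face_order) (flags face_order)
        (flag_action face_order)) = 2"
      using orbit_flag_neq[of x ?y] x y by simp
  next
    fix \<Phi> \<Psi> assume adj: "adjacent face_order rank \<Phi> \<Psi>"
    then have "\<Phi> \<in> flag ` X" "\<Psi> \<in> flag ` X"
      by (auto simp: adjacent_def adjacent_at_def flags_face_order)
    then obtain x y where xy: "x \<in> X" "y \<in> X" "\<Phi> = flag x" "\<Psi> = flag y" by blast
    then obtain i where "i \<in> D" "y = act i x" using adjacent_flagE adj by blast
    then show "?orb \<Phi> \<noteq> ?orb \<Psi>" using xy orbit_flag_neq[of x y] par_act[of i x] by auto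
  qed
qed

text \<open>The action is simply transitive on a parity class: an automorphism is determined by the
  image of the flag of \<open>b\<close>, and every flag of the same parity occurs as an
  image.\<close>

lemma order_automorphism_group:
  assumes b: "b \<in> X"
  shows "order (automorphism_group face_order) = card {x \<in> X. par x = par b}"
proof -
  let ?A = "carrier (automorphism_group face_order)"
  have "bij_betw (\<lambda>f. f ` flag b) ?A (flag ` {x \<in> X. par x = par b})"
    unfolding bij_betw_def
  proof
    show "inj_on (\<lambda>f. f ` flag b) ?A"
    proof (rule inj_onI)
      fix f g assume fg: "f \<in> ?A" "g \<in> ?A" "f ` flag b = g ` flag b"
      obtain \<phi> where \<phi>: "symmetry \<phi>" "\<forall>x\<in>X. \<forall>j\<in>R. f (face j x) = face j (\<phi> x)"
        using automorphism_symmetry fg by blast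
      obtain \<psi> where \<psi>: "symmetry \<psi>" "\<forall>x\<in>X. \<forall>j\<in>R. g (face j x) = face j (\<psi> x)"
        using automorphism_symmetry fg by blast
      have "flag (\<phi> b) = flag (\<psi> b)"
        using image_flag[of f b "\<phi> b"] image_flag[of g b "\<psi> b"] \<phi> \<psi> fg(3) b by simp
      then have "\<phi> b = \<psi> b" using flag_inj symmetry_closed \<phi>(1) \<psi>(1) b by blast
      then have eq: "\<phi> x = \<psi> x" if "x \<in> X" for x
        using symmetry_unique \<phi>(1) \<psi>(1) b that by blast
      show "f = g"
      proof (rule extensionalityI)
        show "f \<in> extensional (Field face_order)" "g \<in> extensional (Field face_order)"
          using automorphismD(1) fg by auto
        fix F assume "F \<in> Field face_order"
        then show "f F = g F" using \<phi>(2) \<psi>(2) eq by (auto simp: Field_face_order)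
      qed
    qed
    have "flag b \<in> flags face_order" using b by (simp add: flags_face_order)
    then have "(\<lambda>f. f ` flag b) ` ?A
        = orbit (automorphism_group face_order) (flag_action face_order) (flag b)"
      by (auto simp: orbit_def flag_action_def)
    then show "(\<lambda>f. f ` flag b) ` ?A = flag ` {x \<in> X. par x = par b}"
      using orbit_flag[OF b] by simp
  qed
  then have "order (automorphism_group face_order) = card (flag ` {x \<in> X. par x = par b})"
    unfolding order_def by (rule bij_betw_same_card)
  also have "\<dots> = card {x \<in> X. par x = par b}"
    by (rule card_image) (auto intro!: inj_onI simp: flag_inj)
  finally show ?thesis .
qed

end

section \<open>Numbering the faces\<close>

text \<open>A component is coded by the least number of a flag in it. Pairing this with the rank
  keeps components of different ranks apart and places the polytope on \<open>nat\<close>.\<close>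

definition face_code :: "nat \<Rightarrow> (int \<Rightarrow> 'x::countable \<Rightarrow> 'x) \<Rightarrow> int \<Rightarrow> 'x \<Rightarrow> nat" where
  "face_code d act j x = to_nat (j, LEAST m. \<exists>y. m = to_nat y \<and>
     labelled_involutions.conn act (labelled_involutions.D d - {j}) x y)"

definition rank_code :: "nat \<Rightarrow> int" where
  "rank_code m = fst (from_nat m :: int \<times> nat)"

lemma flag_system_face_code:
  fixes act :: "int \<Rightarrow> 'x::countable \<Rightarrow> 'x"
  assumes "flag_graph d act X par"
  shows "flag_system d act X par (face_code d act) rank_code"
proof -
  interpret flag_graph d act X par by fact
  let ?m = "\<lambda>j x. LEAST m. \<exists>y. m = to_nat y \<and> conn (D - {j}) x y"
  have code: "face_code d act j x = to_nat (j, ?m j x)" for j x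
    by (simp add: face_code_def)
  have attained: "\<exists>y. ?m j x = to_nat y \<and> conn (D - {j}) x y" for j x
    by (rule LeastI[of _ "to_nat x"]) auto
  show ?thesis
  proof unfold_locales
    fix j k x y assume *: "j \<in> R" "k \<in> R" "x \<in> X" "y \<in> X"
    show "face_code d act j x = face_code d act k y \<longleftrightarrow> j = k \<and> conn (D - {j}) x y"
    proof
      assume "face_code d act j x = face_code d act k y"
      then have eq: "j = k" "?m j x = ?m j y" by (auto simp: code)
      obtain z w where z: "?m j x = to_nat z" "conn (D - {j}) x z"
          "?m j y = to_nat w" "conn (D - {j}) y w"
        using attained by metis
      then have "z = w" using eq(2) by simp
      then show "j = k \<and> conn (D - {j}) x y"
        using conn_trans[OF z(2) conn_sym[of "D - {j}" y z]] z(4) eq(1) * by auto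
    next
      assume "j = k \<and> conn (D - {j}) x y"
      then have eq: "j = k" "conn (D - {j}) x y" "conn (D - {j}) y x"
        using conn_sym[of "D - {j}" x y] * by auto
      then have "conn (D - {j}) x = conn (D - {j}) y"
        using conn_trans by (intro ext iffI) blast+
      then show "face_code d act j x = face_code d act k y" using eq(1) by (simp add: code)
    qed
  next
    show "rank_code (face_code d act j x) = j" for j x
      by (simp add: code rank_code_def)
  qed
qed

text \<open>A period that divides 4 but not 2 is 4.\<close>

lemma funpow_eq_self_iff_4:
  assumes "(f ^^ 4) x = x" "(f ^^ 2) x \<noteq> x"
  shows "(f ^^ j) x = x \<longleftrightarrow> 4 dvd j"
proof -
  have mod: "(f ^^ (j mod 4)) x = (f ^^ j) x" using funpow_mod_eq[OF assms(1)] .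
  have f4: "f (f (f (f x))) = x" and f2: "f (f x) \<noteq> x" using assms by (simp_all add: eval_nat_numeral)
  have "f x \<noteq> x" using f2 by auto
  moreover have "f (f (f x)) \<noteq> x" using f4 f2 calculation by metis
  ultimately have "(f ^^ m) x = x \<longleftrightarrow> m = 0" if "m = 0 \<or> m = 1 \<or> m = 2 \<or> m = 3" for m
    using that f2 by (elim disjE) (simp_all add: eval_nat_numeral)
  moreover have "j mod 4 = 0 \<or> j mod 4 = 1 \<or> j mod 4 = 2 \<or> j mod 4 = 3" by presburger
  ultimately have "(f ^^ j) x = x \<longleftrightarrow> j mod 4 = 0" unfolding mod[symmetric] .
  then show ?thesis by presburger
qed

section \<open>The action on 32 facets\<close>

type_synonym facet = "bool \<times> bool \<times> bool \<times> bool \<times> bool"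

text \<open>
  The first four bits \<open>(a, b, g, h)\<close> encode the element \<open>x\<^sup>a y\<^sup>b z\<^sup>g u\<^sup>h\<close> of \<open>C\<^sub>2 \<times> D\<^sub>4\<close>, where \<open>u\<close> generates the
  first factor, \<open>x\<close> and \<open>y\<close> are reflections generating the second, and \<open>z = [x, y]\<close>; the bit \<open>p\<close> selects the
  copy. The square \<open>(m, n)\<close> enters only through the parities \<open>X\<close>, \<open>Y\<close>, \<open>Z\<close> of \<open>m\<close>, \<open>n\<close> and
  \<open>m div 2 + n div 2\<close>. The involution right multiplies the first copy by a group element \<open>t\<close> depending
  on the square and the second copy by the inverse of \<open>t\<close>.
\<close>

fun twist :: "bool \<Rightarrow> bool \<Rightarrow> bool \<Rightarrow> facet \<Rightarrow> facet" where
  "twist X Y Z (a, b, g, h, p) =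
     (a \<noteq> Y, b \<noteq> X, g \<noteq> ((Z \<and> X \<noteq> Y) \<noteq> ((X \<and> Y) \<noteq> ((b \<and> Y) \<noteq> (p \<and> X \<and> Y)))),
      h \<noteq> (Z \<noteq> (X \<and> Y)), \<not> p)"

definition cross :: "int \<times> int \<Rightarrow> facet \<Rightarrow> facet" where
  "cross f = twist (odd (fst f)) (odd (snd f)) (odd (fst f div 2 + snd f div 2))"

lemma twist_twist: "twist X Y Z (twist X Y Z c) = c"
  by (cases c; cases X; cases Y; cases Z) auto

text \<open>The altered parameters belong to the square to the right and to the square above: m div
  2 grows on passing to m + 1 exactly when m is odd. Commutation and distinctness give order exactly
  4 to the rotations with labels 2 and 3.\<close>

lemma twist_adjacent:
  "twist X Y Z (twist (\<not> X) Y (Z \<noteq> X) c) = twist (\<not> X) Y (Z \<noteq> X) (twist X Y Z c)"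
  "twist X Y Z (twist X (\<not> Y) (Z \<noteq> Y) c) = twist X (\<not> Y) (Z \<noteq> Y) (twist X Y Z c)"
  "twist (\<not> X) Y (Z \<noteq> X) c \<noteq> twist X Y Z c"
  "twist X (\<not> Y) (Z \<noteq> Y) c \<noteq> twist X Y Z c"
  by (cases c; cases X; cases Y; cases Z; auto)+

lemma odd_div_2_add_1: "odd (((x::int) + 1) div 2 + y) \<longleftrightarrow> (odd (x div 2 + y) \<noteq> odd x)"
  "odd (y + ((x::int) + 1) div 2) \<longleftrightarrow> (odd (y + x div 2) \<noteq> odd x)"
  by presburger+

lemma cross_cross: "cross f (cross f c) = c"
  by (simp add: cross_def twist_twist)

lemma cross_shift:
  "cross (f + (1, 0)) = twist (\<not> odd (fst f)) (odd (snd f)) (odd (fst f div 2 + snd f div 2) \<noteq> odd (fst f))"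
  "cross (f + (0, 1)) = twist (odd (fst f)) (\<not> odd (snd f)) (odd (fst f div 2 + snd f div 2) \<noteq> odd (snd f))"
  unfolding cross_def using odd_div_2_add_1[of "fst f" "snd f div 2"] odd_div_2_add_1(2)[of "fst f div 2" "snd f"]
  by (simp_all)

lemma cross_commute:
  "cross f (cross (f + (1, 0)) c) = cross (f + (1, 0)) (cross f c)"
  "cross f (cross (f + (0, 1)) c) = cross (f + (0, 1)) (cross f c)"
  "cross (f + (1, 0)) c \<noteq> cross f c"
  "cross (f + (0, 1)) c \<noteq> cross f c"
  unfolding cross_shift unfolding cross_def by (rule twist_adjacent)+

text \<open>The three maps lift the reflections (m, n) to (m, -n), (n, m) and (1 - m, n) of the
  squares to the facets, as \<open>facet_map_cross\<close> shows. Each of them interchanges the two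
  copies.\<close>

fun facet_map0 :: "facet \<Rightarrow> facet" where
  "facet_map0 (a, b, g, h, p) = (a, b, g \<noteq> a, h \<noteq> a, \<not> p)"

fun facet_map1 :: "facet \<Rightarrow> facet" where
  "facet_map1 (a, b, g, h, p) = (b, a, g \<noteq> (a \<and> b), h, \<not> p)"

fun facet_map2 :: "facet \<Rightarrow> facet" where
  "facet_map2 (a, b, g, h, p) = (a, b \<noteq> (\<not> p), (h \<noteq> g) \<noteq> a, h \<noteq> a, \<not> p)"

lemma facet_map_twist:
  "facet_map0 (twist X Y Z c) = twist X Y (Z \<noteq> Y) (facet_map0 c)"
  "facet_map1 (twist X Y Z c) = twist Y X Z (facet_map1 c)"
  "facet_map2 (twist X Y Z c) = twist (\<not> X) Y Z (facet_map2 c)"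
  by (cases c; cases X; cases Y; cases Z; auto)+

lemma odd_div_2_reflect:
  "odd ((k::int) + (- n) div 2) \<longleftrightarrow> (odd (k + n div 2) \<noteq> odd n)"
  "odd ((1 - n) div 2 + (k::int)) \<longleftrightarrow> odd (n div 2 + k)"
  by presburger+

lemma facet_map_cross:
  "facet_map0 (cross f c) = cross (fst f, - snd f) (facet_map0 c)"
  "facet_map1 (cross f c) = cross (snd f, fst f) (facet_map1 c)"
  "facet_map2 (cross f c) = cross (1 - fst f, snd f) (facet_map2 c)"
  using odd_div_2_reflect(1)[of "fst f div 2" "snd f"] odd_div_2_reflect(2)[of "fst f" "snd f div 2"]
  by (simp_all add: cross_def facet_map_twist add.commute)

lemma cross_eval:
  "cross (0, 0) = twist False False False" "cross (1, 0) = twist True False False"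
  "cross (0, 1) = twist False True False" "cross (1, 1) = twist True True False"
  "cross (1, 2) = twist True False True"
  by (simp_all add: cross_def)

section \<open>The flag graph over a square torus\<close>

text \<open>
  A flag \<open>(c, f, bx, by, s)\<close> consists of a facet, a square, the corner of the square in direction \<open>bx\<close>
  (right or left) and \<open>by\<close> (top or bottom), and the side of the square at that corner: the
  vertical one if \<open>s\<close>, the horizontal one otherwise. The assumption \<open>L_even\<close> below says that \<open>L\<close> lies in
  the lattice generated by \<open>(2, 2)\<close> and \<open>(2, -2)\<close>.
\<close>

type_synonym cell = "facet \<times> (int \<times> int) \<times> bool \<times> bool \<times> bool"

locale square_torus =
  fixes red :: "int \<times> int \<Rightarrow> int \<times> int" and L :: "(int \<times> int) set"
  assumes red_eq_iff: "red u = red v \<longleftrightarrow> u - v \<in> L"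
    and red_red: "red (red u) = red u"
    and L_even: "(x, y) \<in> L \<Longrightarrow> even x \<and> even y \<and> even (x div 2 + y div 2)"
    and L_reflect: "(x, y) \<in> L \<Longrightarrow> (- x, y) \<in> L"
    and L_swap: "(x, y) \<in> L \<Longrightarrow> (y, x) \<in> L"
    and finite_range_red: "finite (range red)"
begin

section \<open>Squares modulo the lattice and the generators on cells\<close>

lemma L_uminus: "v \<in> L \<Longrightarrow> - v \<in> L"
  using red_eq_iff[of v 0] red_eq_iff[of 0 v] by simp

lemma red_minus_in_L: "red u - u \<in> L"
  using red_eq_iff red_red by blast

lemma red_add [simp]: "red (red u + v) = red (u + v)"
  using red_minus_in_L[of u] by (simp add: red_eq_iff)

text \<open>By \<open>L_even\<close> a translation in \<open>L\<close> preserves all three parities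
  on which \<open>cross\<close> depends.\<close>

lemma cross_cong:
  assumes "u - v \<in> L"
  shows "cross u = cross v"
proof -
  obtain x y x' y' where u: "u = (x, y)" and v: "v = (x', y')" by (cases u; cases v)
  have "even (x - x')" "even (y - y')" and e: "even ((x - x') div 2 + (y - y') div 2)"
    using L_even[of "x - x'" "y - y'"] assms by (auto simp: u v)
  then obtain k l where "x - x' = 2 * k" "y - y' = 2 * l" by (elim evenE)
  then have kl: "x = x' + 2 * k" "y = y' + 2 * l" "even (k + l)" using e by auto
  have "x div 2 + y div 2 = (x' div 2 + y' div 2) + (k + l)" by (simp add: kl)
  then have "odd (x div 2 + y div 2) = odd (x' div 2 + y' div 2)" using kl(3) by simp
  then show ?thesis using kl(1,2) by (simp add: cross_def u v)
qed

lemma cross_red [simp]: "cross (red u) = cross u"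
  by (rule cross_cong) (rule red_minus_in_L)

lemma cross_red_add [simp]: "cross (red u + v) = cross (u + v)"
  by (metis cross_red red_add)

lemma cross_neighbours:
  "cross (f + (1, 0)) (cross f c) = cross f (cross (f + (1, 0)) c)"
  "cross (f + (0, 1)) (cross f c) = cross f (cross (f + (0, 1)) c)"
  "cross (f + (-1, 0)) (cross f c) = cross f (cross (f + (-1, 0)) c)"
  "cross (f + (0, -1)) (cross f c) = cross f (cross (f + (0, -1)) c)"
  "cross (f + (-1, 0)) c \<noteq> cross f c"
  "cross (f + (0, -1)) c \<noteq> cross f c"
  using cross_commute[of f c] cross_commute[of "f + (-1, 0)" c] cross_commute[of "f + (0, -1)" c]
  by (auto simp: add.assoc zero_prod_def[symmetric])

text \<open>Labels 0, 1, 2 change the vertex, the edge and the square of the toroidal flag, and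
  label 3 changes the facet. A condition of the form \<open>bx \<noteq> c\<close> flips the bit when
  \<open>c\<close> holds; label 0 moves the corner along its side, so \<open>s\<close> decides which
  coordinate flips.\<close>

fun step :: "int \<Rightarrow> cell \<Rightarrow> cell" where
  "step i (c, f, bx, by, s) =
    (if i = 0 then (c, f, bx \<noteq> (\<not> s), by \<noteq> s, s)
     else if i = 1 then (c, f, bx, by, \<not> s)
     else if i = 2 then
       (if s then (c, red (f + (if bx then 1 else -1, 0)), \<not> bx, by, s)
        else (c, red (f + (0, if by then 1 else -1)), bx, \<not> by, s))
     else (cross f c, f, bx, by, s))"

definition cells :: "cell set" where
  "cells = UNIV \<times> range red \<times> UNIV \<times> UNIV \<times> UNIV"

text \<open>Every generator flips exactly one of the bits \<open>p\<close>, \<open>bx\<close>,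
  \<open>by\<close>, \<open>s\<close>.\<close>

fun cell_par :: "cell \<Rightarrow> bool" where
  "cell_par ((a, b, g, h, p), f, bx, by, s) = (p \<noteq> (bx \<noteq> (by \<noteq> s)))"

fun vert :: "cell \<Rightarrow> int \<times> int" where
  "vert (c, f, bx, by, s) = red (f + (of_bool bx, of_bool by))"

text \<open>An edge is named by its orientation and the square of which it is the left or the bottom
  side.\<close>

fun edge :: "cell \<Rightarrow> bool \<times> int \<times> int" where
  "edge (c, f, bx, by, s) = (s, if s then red (f + (of_bool bx, 0)) else red (f + (0, of_bool by)))"

interpretation labelled_involutions 4 step .

lemma D_eq: "D = {0, 1, 2, 3}"
  by (auto simp: D_def)

lemma red_range: "f \<in> range red \<Longrightarrow> red f = f"
  using red_red by auto

lemma in_cells: "(c, f, bx, by, s) \<in> cells \<longleftrightarrow> f \<in> range red"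
  by (auto simp: cells_def)

lemma step_closed: "x \<in> cells \<Longrightarrow> step i x \<in> cells"
  by (cases x) (simp add: in_cells)

lemma step_step:
  assumes "x \<in> cells"
  shows "step i (step i x) = x"
proof -
  obtain c f bx "by" s where x: "x = (c, f, bx, by, s)" by (cases x)
  have "f \<in> range red" using assms by (simp only: x in_cells)
  then have f: "red f = f" by (rule red_range)
  show ?thesis
    by (cases s; cases bx; cases "by") (simp_all add: x f cross_cross add.assoc flip: zero_prod_def)
qed

lemma par_cross: "snd (snd (snd (snd (cross f c)))) \<longleftrightarrow> \<not> snd (snd (snd (snd c)))"
  by (cases c) (simp add: cross_def)

lemma cell_par_alt: "cell_par (c, f, bx, by, s) = (snd (snd (snd (snd c))) \<noteq> (bx \<noteq> (by \<noteq> s)))"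
  by (cases c) simp

lemma par_step: "cell_par (step i x) \<longleftrightarrow> \<not> cell_par x"
  by (cases x) (auto simp: cell_par_alt par_cross simp del: cell_par.simps)

lemma step_commute: "i \<in> {0,1,2,3} \<Longrightarrow> j \<in> {0,1,2,3} \<Longrightarrow> i + 1 < j \<Longrightarrow> step i (step j x) = step j (step i x)"
  by (cases x) auto

lemma conn_stepI: "i \<in> I \<Longrightarrow> step i x = y \<Longrightarrow> conn I x y"
  using conn_step by blast

lemma conn_cells: "conn I x y \<Longrightarrow> x \<in> cells \<Longrightarrow> y \<in> cells"
  by (induction rule: conn_induct) (auto intro: step_closed)

lemma conn_flip: "conn I x y \<Longrightarrow> x \<in> cells \<Longrightarrow> conn I y x"
proof (induction rule: conn_induct)
  case (step y i)
  then have "conn I (step i y) y" using conn_stepI[of i I "step i y" y] step_step conn_cells by blast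
  then show ?case using step conn_trans by blast
qed simp

lemma conn_side: "1 \<in> I \<Longrightarrow> conn I (c, f, bx, by, s) (c, f, bx, by, s')"
  using conn_step[of 1 I "(c, f, bx, by, s)"] by (cases "s = s'") auto

lemma conn_cross: "3 \<in> I \<Longrightarrow> conn I (c, f, bx, by, s) (cross f c, f, bx, by, s)"
  using conn_step[of 3 I "(c, f, bx, by, s)"] by auto

lemma conn_corner: "0 \<in> I \<Longrightarrow> conn I (c, f, bx, by, s) (c, f, bx \<noteq> (\<not> s), by \<noteq> s, s)"
  using conn_step[of 0 I "(c, f, bx, by, s)"] by auto

lemma conn_within_square:
  assumes "0 \<in> I" "1 \<in> I"
  shows "conn I (c, f, bx, by, s) (c, f, bx', by', s')"
proof -
  have 1: "conn I (c, f, bx, by, s) (c, f, bx', by, s)" for bx bx' "by" s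
  proof (cases "bx = bx'")
    case False
    have "conn I (c, f, bx, by, s) (c, f, bx, by, False)" by (rule conn_side) fact
    also have "conn I (c, f, bx, by, False) (c, f, bx', by, False)"
      using conn_corner[of I c f bx "by" False] False assms by (cases bx) auto
    also have "conn I (c, f, bx', by, False) (c, f, bx', by, s)" by (rule conn_side) fact
    finally show ?thesis .
  qed simp
  have 2: "conn I (c, f, bx, by, s) (c, f, bx, by', s)" for bx "by" by' s
  proof (cases "by = by'")
    case False
    have "conn I (c, f, bx, by, s) (c, f, bx, by, True)" by (rule conn_side) fact
    also have "conn I (c, f, bx, by, True) (c, f, bx, by', True)"
      using conn_corner[of I c f bx "by" True] False assms by (cases "by") auto
    also have "conn I (c, f, bx, by', True) (c, f, bx, by', s)" by (rule conn_side) fact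
    finally show ?thesis .
  qed simp
  show ?thesis using 1 2 conn_side[OF assms(2)] conn_trans by metis
qed

text \<open>Vectors of \<open>L\<close> have even coordinates, so the corners of one square, and its
  opposite sides, stay distinct on the torus.\<close>

lemma red_shift_eqD:
  assumes "red (f + (m, n)) = red (f + (m', n'))"
  shows "even (m - m')" "even (n - n')"
  using assms L_even[of "m - m'" "n - n'"] by (simp_all add: red_eq_iff)

lemma red_eq_trans:
  assumes "red (f + u) = red (f' + u)" "f \<in> range red" "f' \<in> range red"
  shows "f = f'"
proof -
  have "f - f' \<in> L" using assms(1) by (simp add: red_eq_iff)
  then have "red f = red f'" by (simp add: red_eq_iff)
  then show ?thesis using assms(2,3) red_range by metis
qed

lemma red_cell_eq:
  assumes "red (f + u) = red (f' + u')" "f' \<in> range red"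
  shows "f' = red (f + (u - u'))"
proof -
  have "red (f + (u - u')) = red (red (f' + u') - u')"
    using assms(1) red_add[of "f + u" "- u'"] by (simp add: algebra_simps)
  also have "\<dots> = red f'" using red_add[of "f' + u'" "- u'"] by simp
  finally show ?thesis using red_range[OF assms(2)] by simp
qed

text \<open>Labels 1 and 2 turn a flag about its vertex; both flags are brought to the square that
  has this vertex as its lower left corner.\<close>

lemma conn_same_vert:
  assumes "x \<in> cells" "y \<in> cells" "1 \<in> I" "2 \<in> I" "fst x = fst y" "vert x = vert y"
  shows "conn I x y"
proof -
  have to_corner: "conn I (c, f, bx, by, s) (c, red (f + (of_bool bx, of_bool by)), False, False, True)"
    if "f \<in> range red" for c f bx "by" s
  proof -
    have f: "red f = f" using that by (rule red_range)
    have 1: "conn I (c, f, bx, by, s) (c, red (f + (of_bool bx, 0)), False, by, True)"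
    proof -
      have "conn I (c, f, bx, by, True) (c, red (f + (of_bool bx, 0)), False, by, True)"
        using conn_stepI[of 2 I "(c, f, bx, by, True)"] assms(4) f
        by (cases bx) (auto simp flip: zero_prod_def)
      then show ?thesis using conn_side[OF assms(3)] conn_trans by blast
    qed
    let ?g = "red (f + (of_bool bx, 0))"
    have "conn I (c, ?g, False, by, False) (c, red (?g + (0, of_bool by)), False, False, False)"
      using conn_stepI[of 2 I "(c, ?g, False, by, False)"] assms(4)
      by (cases "by") (auto simp: red_red simp flip: zero_prod_def)
    moreover have "red (?g + (0, of_bool by)) = red (f + (of_bool bx, of_bool by))"
      by (simp add: add.assoc)
    ultimately show ?thesis using 1 conn_side[OF assms(3)] conn_trans by metis
  qed
  obtain c f bx "by" s where x: "x = (c, f, bx, by, s)" by (cases x)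
  obtain c' f' bx' by' s' where y: "y = (c', f', bx', by', s')" by (cases y)
  have "conn I y (c, red (f + (of_bool bx, of_bool by)), False, False, True)"
    using to_corner[of f' c' bx' by' s'] assms by (simp add: x y in_cells)
  then have "conn I (c, red (f + (of_bool bx, of_bool by)), False, False, True) y"
    using conn_flip assms(2) by blast
  moreover have "conn I x (c, red (f + (of_bool bx, of_bool by)), False, False, True)"
    using to_corner[of f c bx "by" s] assms(1) by (simp add: x in_cells)
  ultimately show ?thesis using conn_trans by blast
qed

lemma conn_same_edge:
  assumes "x \<in> cells" "y \<in> cells" "0 \<in> I" "2 \<in> I" "fst x = fst y" "edge x = edge y"
  shows "conn I x y"
proof -
  define nf :: "facet \<Rightarrow> bool \<times> int \<times> int \<Rightarrow> cell"
    where "nf c e = (c, snd e, False, False, fst e)" for c e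
  have to_nf: "conn I x (nf (fst x) (edge x))" if "x \<in> cells" for x
  proof -
    obtain c f bx "by" s where x: "x = (c, f, bx, by, s)" by (cases x)
    have "f \<in> range red" using that by (simp only: x in_cells)
    then have f: "red f = f" by (rule red_range)
    show ?thesis
    proof (cases s)
      case True
      have "conn I (c, f, bx, by, True) (c, red (f + (of_bool bx, 0)), False, by, True)"
        using conn_stepI[of 2 I "(c, f, bx, by, True)"] assms(4) f
        by (cases bx) (auto simp flip: zero_prod_def)
      also have "conn I \<dots> (c, red (f + (of_bool bx, 0)), False, False, True)"
        using conn_corner[of I c "red (f + (of_bool bx, 0))" False "by" True] assms(3) by (cases "by") auto
      finally show ?thesis using True by (simp add: x nf_def)
    next
      case False
      have "conn I (c, f, bx, by, False) (c, red (f + (0, of_bool by)), bx, False, False)"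
        using conn_stepI[of 2 I "(c, f, bx, by, False)"] assms(4) f
        by (cases "by") (auto simp flip: zero_prod_def)
      also have "conn I \<dots> (c, red (f + (0, of_bool by)), False, False, False)"
        using conn_corner[of I c "red (f + (0, of_bool by))" bx False False] assms(3) by (cases bx) auto
      finally show ?thesis using False by (simp add: x nf_def)
    qed
  qed
  have "conn I (nf (fst y) (edge y)) y" using conn_flip to_nf assms(2) by blast
  then show ?thesis using to_nf[OF assms(1)] assms(5,6) conn_trans by auto
qed

text \<open>The two squares at an edge have commuting involutions, so these four facets are closed
  under both.\<close>

definition edge_orbit :: "bool \<times> int \<times> int \<Rightarrow> facet \<Rightarrow> facet set" where
  "edge_orbit e c = (let E = cross (snd e); E' = cross (snd e + (if fst e then (-1, 0) else (0, -1)))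
     in {c, E c, E' c, E (E' c)})"

lemma edge_orbit_step:
  assumes "c' \<in> edge_orbit e c"
  shows "cross (snd e) c' \<in> edge_orbit e c"
    "cross (snd e + (if fst e then (-1, 0) else (0, -1))) c' \<in> edge_orbit e c"
proof -
  define E E' where "E = cross (snd e)"
    and "E' = cross (snd e + (if fst e then (-1, 0) else (0, -1)))"
  have inv: "E (E c) = c" "E' (E' c) = c" for c by (simp_all add: E_def E'_def cross_cross)
  have comm: "E' (E c) = E (E' c)"
    unfolding E_def E'_def using cross_neighbours(3,4)[of "snd e" c] by (simp split: if_split)
  have orbit: "edge_orbit e c = {c, E c, E' c, E (E' c)}"
    by (simp add: edge_orbit_def E_def E'_def Let_def)
  have "E' (E (E' c)) = E c" using inv comm by metis
  then have "E c' \<in> edge_orbit e c" "E' c' \<in> edge_orbit e c"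
    using assms inv[of c] inv(1)[of "E' c"] comm unfolding orbit by auto
  then show "cross (snd e) c' \<in> edge_orbit e c"
    "cross (snd e + (if fst e then (-1, 0) else (0, -1))) c' \<in> edge_orbit e c"
    by (simp_all only: E_def E'_def)
qed

lemma cross_edge:
  assumes "edge (c, f, bx, by, s) = e"
  shows "cross f = cross (snd e) \<or> cross f = cross (snd e + (if fst e then (-1, 0) else (0, -1)))"
  unfolding assms[symmetric]
  by (cases s; cases bx; cases "by") (auto simp: add.assoc simp flip: zero_prod_def)

text \<open>This and the next lemmas \<open>conn_no_2\<close>, \<open>conn_no_1\<close>,
  \<open>conn_no_0\<close> find what paths omitting one label preserve.
  \<open>cell_intersection\<close> uses these necessary conditions to recover a path.\<close>

lemma conn_no_3: "conn I x y \<Longrightarrow> I \<subseteq> {0, 1, 2} \<Longrightarrow> fst y = fst x"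
proof (induction rule: conn_induct)
  case (step y i)
  then show ?case by (cases y) auto
qed simp

lemma conn_no_2: "conn I x y \<Longrightarrow> I \<subseteq> {0, 1, 3} \<Longrightarrow>
    fst (snd y) = fst (snd x) \<and> (fst y = fst x \<or> fst y = cross (fst (snd x)) (fst x))"
proof (induction rule: conn_induct)
  case (step y i)
  then show ?case by (cases y) (auto simp: cross_cross)
qed simp

lemma edge_step: "i \<in> {0, 2, 3} \<Longrightarrow> edge (step i y) = edge y"
  by (cases y) (auto simp: add.assoc simp flip: zero_prod_def)

lemma conn_no_1: "conn I x y \<Longrightarrow> I \<subseteq> {0, 2, 3} \<Longrightarrow>
    edge y = edge x \<and> fst y \<in> edge_orbit (edge x) (fst x)"
proof (induction rule: conn_induct)
  case refl
  then show ?case by (simp add: edge_orbit_def Let_def)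
next
  case (step y i)
  then have IH: "edge y = edge x" "fst y \<in> edge_orbit (edge x) (fst x)" and i: "i \<in> {0, 2, 3}" by auto
  obtain c f bx "by" s where y: "y = (c, f, bx, by, s)" by (cases y)
  have "cross f = cross (snd (edge x)) \<or>
      cross f = cross (snd (edge x) + (if fst (edge x) then (-1, 0) else (0, -1)))"
    using IH(1) unfolding y by (rule cross_edge)
  moreover have "c \<in> edge_orbit (edge x) (fst x)" using IH(2) by (simp add: y)
  ultimately have "cross f c \<in> edge_orbit (edge x) (fst x)" using edge_orbit_step by metis
  then have "fst (step i y) \<in> edge_orbit (edge x) (fst x)" using IH(2) i by (auto simp: y)
  then show ?case using edge_step[OF i] IH(1) by simp
qed

lemma conn_no_0: "conn I x y \<Longrightarrow> I \<subseteq> {1, 2, 3} \<Longrightarrow> vert y = vert x"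
proof (induction rule: conn_induct)
  case (step y i)
  then have "vert (step i y) = vert y" by (cases y) (auto simp: add.assoc)
  then show ?case using step by simp
qed simp

text \<open>The two ends of an edge are distinct on the torus, so edge and vertex determine the
  toroidal flag up to the choice of a square at the edge.\<close>

lemma same_edge_vert:
  assumes "x \<in> cells" "y \<in> cells" "edge x = edge y" "vert x = vert y"
  shows "snd y = snd x \<or> snd y = snd (step 2 x)"
proof -
  obtain c f bx "by" s where x: "x = (c, f, bx, by, s)" by (cases x)
  obtain c' f' bx' by' s' where y: "y = (c', f', bx', by', s')" by (cases y)
  have f: "f \<in> range red" "f' \<in> range red" using assms(1,2) by (simp_all only: x y in_cells)
  have s': "s' = s" using assms(3) by (simp add: x y)
  show ?thesis
  proof (cases s)
    case True
    have e: "red (f + (of_bool bx, 0)) = red (f' + (of_bool bx', 0))"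
      using assms(3) True by (simp add: x y)
    have "red (f + (of_bool bx, of_bool by)) = red (f' + (of_bool bx', of_bool by'))"
      using assms(4) by (simp add: x y)
    then have "red (red (f + (of_bool bx, 0)) + (0, of_bool by))
        = red (red (f' + (of_bool bx', 0)) + (0, of_bool by'))"
      by (simp add: add.assoc)
    then have "red ((f' + (of_bool bx', 0)) + (0, of_bool by)) = red ((f' + (of_bool bx', 0)) + (0, of_bool by'))"
      unfolding e red_add .
    then have "even (of_bool by - of_bool by' :: int)" by (rule red_shift_eqD(2))
    then have "by' = by" by (cases "by"; cases by') simp_all
    moreover have "f' = f" if "bx' = bx"
      using red_eq_trans[of f "(of_bool bx, 0)" f'] e f that by simp
    moreover have "f' = red (f + (of_bool bx - of_bool bx', 0))"
      using red_cell_eq[OF e f(2)] by simp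
    ultimately show ?thesis using True s' by (cases bx; cases bx') (auto simp: x y)
  next
    case False
    have e: "red (f + (0, of_bool by)) = red (f' + (0, of_bool by'))"
      using assms(3) False s' by (simp add: x y)
    have "red (f + (of_bool bx, of_bool by)) = red (f' + (of_bool bx', of_bool by'))"
      using assms(4) by (simp add: x y)
    then have "red (red (f + (0, of_bool by)) + (of_bool bx, 0))
        = red (red (f' + (0, of_bool by')) + (of_bool bx', 0))"
      by (simp add: add.assoc)
    then have "red ((f' + (0, of_bool by')) + (of_bool bx, 0)) = red ((f' + (0, of_bool by')) + (of_bool bx', 0))"
      unfolding e red_add .
    then have "even (of_bool bx - of_bool bx' :: int)" by (rule red_shift_eqD(1))
    then have "bx' = bx" by (cases bx; cases bx') simp_all
    moreover have "f' = f" if "by' = by"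
      using red_eq_trans[of f "(0, of_bool by)" f'] e f that by simp
    moreover have "f' = red (f + (0, of_bool by - of_bool by'))"
      using red_cell_eq[OF e f(2)] by simp
    ultimately show ?thesis using False s' by (cases "by"; cases by') (auto simp: x y)
  qed
qed

lemma conn_translate:
  assumes I: "0 \<in> I" "1 \<in> I" "2 \<in> I"
  shows "conn I (c, red u, bx, by, s) (c, red v, bx', by', s')"
proof -
  have unit: "conn I (c, red u, True, True, True) (c, red (u + w), True, True, True)"
    if w: "w \<in> {(1, 0), (-1, 0), (0, 1), (0, -1)}" for u w
  proof -
    \<comment> \<open>\<open>t\<close> selects the side of the square that faces direction
      \<open>w\<close>.\<close>
    have "\<exists>t bx by s. step 2 (c, red u, t) = (c, red (u + w), bx, by, s)"
    proof -
      consider "w = (1, 0)" | "w = (-1, 0)" | "w = (0, 1)" | "w = (0, -1)" using w by blast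
      then show ?thesis
      proof cases
        case 1 then show ?thesis by (intro exI[of _ "(True, True, True)"]) auto
      next
        case 2 then show ?thesis by (intro exI[of _ "(False, True, True)"]) auto
      next
        case 3 then show ?thesis by (intro exI[of _ "(True, True, False)"]) auto
      next
        case 4 then show ?thesis by (intro exI[of _ "(True, False, False)"]) auto
      qed
    qed
    then obtain t bx "by" s where st: "step 2 (c, red u, t) = (c, red (u + w), bx, by, s)" by blast
    have "conn I (c, red u, True, True, True) (c, red u, t)"
      using conn_within_square[OF I(1,2)] by (cases t) blast
    also have "conn I (c, red u, t) (c, red (u + w), bx, by, s)"
      using conn_stepI[OF I(3) st] .
    also have "conn I \<dots> (c, red (u + w), True, True, True)" using conn_within_square[OF I(1,2)] .
    finally show ?thesis .
  qed
  have X: "conn I (c, red u, True, True, True) (c, red (u + (m, 0)), True, True, True)" for u m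
  proof (induction m rule: int_induct[where k = 0])
    case base
    then show ?case by (simp flip: zero_prod_def)
  next
    case (step1 m)
    then show ?case using conn_trans[OF step1(2) unit[of "(1, 0)"]] by (simp add: add.assoc)
  next
    case (step2 m)
    then show ?case using conn_trans[OF step2(2) unit[of "(-1, 0)"]] by (simp add: add.assoc)
  qed
  have Y: "conn I (c, red u, True, True, True) (c, red (u + (0, m)), True, True, True)" for u m
  proof (induction m rule: int_induct[where k = 0])
    case base
    then show ?case by (simp flip: zero_prod_def)
  next
    case (step1 m)
    then show ?case using conn_trans[OF step1(2) unit[of "(0, 1)"]] by (simp add: add.assoc)
  next
    case (step2 m)
    then show ?case using conn_trans[OF step2(2) unit[of "(0, -1)"]] by (simp add: add.assoc)
  qed
  obtain m n where mn: "v - u = (m, n)" by (cases "v - u")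
  then have v: "v = u + (m, 0) + (0, n)" by (simp add: add.assoc flip: mn)
  have "conn I (c, red u, bx, by, s) (c, red u, True, True, True)" using conn_within_square[OF I(1,2)] .
  also have "conn I \<dots> (c, red (u + (m, 0)), True, True, True)" using X .
  also have "conn I \<dots> (c, red v, True, True, True)" unfolding v using Y .
  also have "conn I \<dots> (c, red v, bx', by', s')" using conn_within_square[OF I(1,2)] .
  finally show ?thesis .
qed

text \<open>Walk to square \<open>v\<close>, cross there, and walk back: every involution is
  available at every position.\<close>

lemma conn_D_cross: "conn D (c, red u, bx, by, s) (cross v c, red u, bx, by, s)"
proof -
  have D: "0 \<in> D" "1 \<in> D" "2 \<in> D" "3 \<in> D" by (simp_all add: D_eq)
  have "conn D (c, red u, bx, by, s) (c, red v, bx, by, s)"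
    using conn_translate[OF D(1-3)] .
  also have "conn D \<dots> (cross v c, red v, bx, by, s)"
    using conn_cross[OF D(4), of c "red v"] by simp
  also have "conn D \<dots> (cross v c, red u, bx, by, s)"
    using conn_translate[OF D(1-3)] .
  finally show ?thesis .
qed

lemma conn_D_facet: "conn D (c, red u, bx, by, s) ((False, False, False, False, False), red u, bx, by, s)"
proof -
  define P where "P c \<longleftrightarrow> conn D (c, red u, bx, by, s) ((False, False, False, False, False), red u, bx, by, s)" for c
  have cross: "P c" if "P (cross v c)" for c v
    using conn_D_cross that conn_trans unfolding P_def by blast
  \<comment> \<open>The bits are cleared in the order a, b, g, h, p; each crossing disturbs only
    bits that are treated for all values already.\<close>
  have p: "P (False, False, False, False, p)" for p
    using cross[of "(0, 0)" "(False, False, False, False, True)"]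
    by (cases p) (simp_all add: cross_def P_def)
  have h: "P (False, False, False, h, p)" for h p
    using cross[of "(2, 0)" "(False, False, False, True, p)"] p by (cases h) (simp_all add: cross_def)
  \<comment> \<open>The two squares have equal parities X and Y but different Z, so the two changes
    of \<open>b\<close> cancel while \<open>g\<close> and \<open>h\<close> change.\<close>
  have g: "P (False, False, g, h, p)" for g h p
    using cross[OF cross[of "(1, 0)" "cross (3, 0) (False, False, True, h, p)"]] h
    by (cases g) (simp_all add: cross_def)
  have b: "P (False, b, g, h, p)" for b g h p
    using cross[of "(1, 0)" "(False, True, g, h, p)"] g by (cases b) (simp_all add: cross_def)
  have "P (a, b, g, h, p)" for a b g h p
    using cross[of "(0, 1)" "(True, b, g, h, p)"] b by (cases a) (simp_all add: cross_def)
  then show ?thesis unfolding P_def by (cases c) auto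
qed

lemma conn_D:
  assumes "x \<in> cells" "y \<in> cells"
  shows "conn D x y"
proof -
  obtain c f bx "by" s where x: "x = (c, f, bx, by, s)" by (cases x)
  obtain c' f' bx' by' s' where y: "y = (c', f', bx', by', s')" by (cases y)
  have "f \<in> range red" "f' \<in> range red" using assms by (simp_all only: x y in_cells)
  then have f: "red f = f" "red f' = f'" using red_range by blast+
  have D: "0 \<in> D" "1 \<in> D" "2 \<in> D" by (simp_all add: D_eq)
  let ?o = "(False, False, False, False, False)"
  have "conn D y (?o, f', bx', by', s')" using conn_D_facet[of c' f'] f by (simp add: y)
  then have "conn D (?o, f', bx', by', s') y" using conn_flip assms(2) by blast
  moreover have "conn D x (?o, f, bx, by, s)" using conn_D_facet[of c f] f by (simp add: x)
  moreover have "conn D (?o, f, bx, by, s) (?o, f', bx', by', s')"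
    using conn_translate[OF D, of ?o f bx "by" s f'] f by simp
  ultimately show ?thesis using conn_trans by blast
qed

text \<open>The invariants of the single deleted labels are combined. If label 2 is deleted
  everything happens inside one square; otherwise flags are compared by their vertex, their edge, or
  both.\<close>

lemma cell_intersection:
  assumes J: "J \<subseteq> D" and x: "x \<in> cells" and y: "y \<in> cells"
    and hyp: "\<And>j. j \<in> J \<Longrightarrow> conn (D - {j}) x y"
  shows "conn (D - J) x y"
proof -
  let ?I = "D - J"
  obtain c f bx "by" s where x': "x = (c, f, bx, by, s)" by (cases x)
  obtain c' f' bx' by' s' where y': "y = (c', f', bx', by', s')" by (cases y)
  have cc: "fst x = c" "fst y = c'" by (simp_all add: x' y')
  have h3: "c' = c" if "3 \<in> J"
    using conn_no_3[OF hyp[OF that]] by (auto simp: D_eq x' y')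
  have h2: "f' = f \<and> (c' = c \<or> c' = cross f c)" if "2 \<in> J"
    using conn_no_2[OF hyp[OF that]] by (auto simp: D_eq x' y')
  have h1: "edge y = edge x \<and> c' \<in> edge_orbit (edge x) c" if "1 \<in> J"
  proof -
    have "D - {1} \<subseteq> {0, 2, 3}" by (auto simp: D_eq)
    from conn_no_1[OF hyp[OF that] this] show ?thesis by (simp only: cc)
  qed
  have h0: "vert y = vert x" if "0 \<in> J"
    using conn_no_0[OF hyp[OF that]] by (auto simp: D_eq)
  show ?thesis
  proof (cases "2 \<in> J")
    case True
    have f': "f' = f" using h2 True by blast
    have to_c': "conn ?I x (c', f, bx, by, s)"
    proof (cases "c' = c")
      case False
      then have "3 \<in> ?I" "c' = cross f c" using h2 h3 True by (auto simp: D_eq)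
      then show ?thesis using conn_cross by (simp add: x')
    qed (simp add: x')
    have corner: "bx' = bx \<and> by' = by" if "0 \<in> J"
    proof -
      have "red (f + (of_bool bx', of_bool by')) = red (f + (of_bool bx, of_bool by))"
        using h0[OF that] by (simp add: x' y' f')
      from red_shift_eqD[OF this] show ?thesis by (cases bx; cases bx'; cases "by"; cases by') simp_all
    qed
    have side: "s' = s \<and> (if s then bx' = bx else by' = by)" if "1 \<in> J"
    proof -
      have "edge y = edge x" using h1[OF that] ..
      moreover have "fst (edge y) = s'" "fst (edge x) = s" by (simp_all add: x' y')
      ultimately have s': "s' = s" and e: "snd (edge y) = snd (edge x)" by simp_all
      show ?thesis
      proof (cases s)
        case True
        then have "red (f + (of_bool bx', 0)) = red (f + (of_bool bx, 0))" using e s' by (simp add: x' y' f')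
        from red_shift_eqD(1)[OF this] show ?thesis using True s' by (cases bx; cases bx') simp_all
      next
        case False
        then have "red (f + (0, of_bool by')) = red (f + (0, of_bool by))" using e s' by (simp add: x' y' f')
        from red_shift_eqD(2)[OF this] show ?thesis using False s' by (cases "by"; cases by') simp_all
      qed
    qed
    have "conn ?I (c', f, bx, by, s) (c', f, bx', by', s')"
    proof (cases "0 \<in> J")
      case True
      then have b: "bx' = bx" "by' = by" using corner by auto
      show ?thesis
      proof (cases "1 \<in> J")
        case True
        then show ?thesis using side b by simp
      next
        case False
        then show ?thesis unfolding b by (intro conn_side) (simp add: D_eq)
      qed
    next
      case False
      then have 0: "0 \<in> ?I" by (simp add: D_eq)
      show ?thesis
      proof (cases "1 \<in> J")
        case True
        then show ?thesis using side conn_corner[OF 0, of c' f bx "by" s]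
          by (cases s; cases bx; cases bx'; cases "by"; cases by') auto
      next
        case False
        then show ?thesis using 0 by (intro conn_within_square) (simp_all add: D_eq)
      qed
    qed
    then show ?thesis using to_c' conn_trans unfolding y' f' by blast
  next
    case False
    then have I2: "2 \<in> ?I" by (simp add: D_eq)
    \<comment> \<open>For a single deleted label the claim is the hypothesis itself, and for none it
      is connectedness.\<close>
    consider "0 \<in> J" "1 \<in> J" | "0 \<in> J" "1 \<notin> J" "3 \<in> J" | "0 \<notin> J" "1 \<in> J" "3 \<in> J"
      | "J \<subseteq> {0}" | "J \<subseteq> {1}" | "J \<subseteq> {3}"
      using J False by (force simp: D_eq)
    then show ?thesis
    proof cases
      case 1
      \<comment> \<open>\<open>?g\<close> is the square across the edge of \<open>x\<close>. The
        toroidal flags of \<open>x\<close> and \<open>y\<close> differ at most by passing to it, so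
        essentially the facet remains to be adjusted.\<close>
      let ?g = "fst (snd (step 2 x))"
      have t: "snd y = snd x \<or> snd y = snd (step 2 x)"
        using same_edge_vert[OF x y] h0 h1 1 by simp
      have flip: "conn ?I (k, snd x) (k, snd (step 2 x))" for k
        by (rule conn_stepI[OF I2]) (cases s; simp add: x')
      have x_in: "(k, snd x) \<in> cells" for k
        using x unfolding cells_def mem_Times_iff by simp
      have target: "conn ?I (k, snd x) y" if "conn ?I (k, snd x) (c', snd x)" for k
      proof -
        have "y = (c', snd y)" by (simp add: y')
        then have "y = (c', snd x) \<or> y = (c', snd (step 2 x))" using t by metis
        then show ?thesis using that flip[of c'] conn_trans by blast
      qed
      show ?thesis
      proof (cases "3 \<in> J")
        case True
        then show ?thesis using target[of c] h3 by (simp add: x')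
      next
        case False
        then have 3: "3 \<in> ?I" by (simp add: D_eq)
        have f: "conn ?I (k, snd x) (cross f k, snd x)" for k
          using conn_cross[OF 3] by (simp add: x')
        have g: "conn ?I (k, snd x) (cross ?g k, snd x)" for k
        proof -
          have "conn ?I (k, snd x) (k, snd (step 2 x))" by (rule flip)
          also have "conn ?I \<dots> (cross ?g k, snd (step 2 x))"
            using conn_stepI[OF 3, of "(k, snd (step 2 x))"] by (cases "step 2 x") simp
          also have "conn ?I \<dots> (cross ?g k, snd x)" using conn_flip[OF flip] x_in by blast
          finally show ?thesis .
        qed
        \<comment> \<open>The name of the edge lists its squares by position, whereas
          \<open>f\<close> and \<open>?g\<close> depend on which of them contains \<open>x\<close>;
          only the unordered pair matches.\<close>
        have sides: "{cross (snd (edge x)), cross (snd (edge x) + (if fst (edge x) then (-1, 0) else (0, -1)))}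
            = {cross f, cross ?g}"
          by (cases s; cases bx; cases "by") (auto simp: x' add.assoc simp flip: zero_prod_def)
        have step_in: "conn ?I (k, snd x) (cross (snd (edge x)) k, snd x)"
          "conn ?I (k, snd x) (cross (snd (edge x) + (if fst (edge x) then (-1, 0) else (0, -1))) k, snd x)" for k
          using f[of k] g[of k] sides by (metis doubleton_eq_iff)+
        have "conn ?I (c, snd x) (c', snd x)"
        proof -
          let ?E = "cross (snd (edge x))"
          let ?E' = "cross (snd (edge x) + (if fst (edge x) then (-1, 0) else (0, -1)))"
          have "c' = c \<or> c' = ?E c \<or> c' = ?E' c \<or> c' = ?E (?E' c)"
            using h1[OF 1(2)] unfolding edge_orbit_def Let_def by simp
          then show ?thesis
            using step_in[of c] conn_trans[OF step_in(2)[of c] step_in(1)] conn_refl by metis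
        qed
        then show ?thesis using target[of c] by (simp add: x')
      qed
    next
      case 2
      then show ?thesis
        using conn_same_vert[OF x y, of ?I] h0 h3 I2 cc D_eq by simp
    next
      case 3
      then show ?thesis
        using conn_same_edge[OF x y, of ?I] h1 h3 I2 cc D_eq by simp
    qed (use hyp conn_D[OF x y] in \<open>auto simp: subset_singleton_iff\<close>)
  qed
qed

lemma flag_graph_cells: "flag_graph 4 step cells cell_par"
proof
  show "cells \<noteq> {}" by (auto simp: cells_def)
  show "step i x \<in> cells" if "x \<in> cells" for i x using that by (rule step_closed)
  show "step i (step i x) = x" if "x \<in> cells" for i x using that by (rule step_step)
  show "cell_par (step i x) \<longleftrightarrow> \<not> cell_par x" for i x by (rule par_step)
  show "step i (step j x) = step j (step i x)" if "i \<in> D" "j \<in> D" "i + 1 < j" for i j x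
    using that by (intro step_commute) (auto simp: D_eq)
  show "conn D x y" if "x \<in> cells" "y \<in> cells" for x y using that by (rule conn_D)
  show "conn (D - J) x y"
    if "J \<subseteq> D" "x \<in> cells" "y \<in> cells" "\<And>j. j \<in> J \<Longrightarrow> conn (D - {j}) x y" for J x y
    using that by (rule cell_intersection)
qed

interpretation flag_graph 4 step cells cell_par
  by (rule flag_graph_cells)

section \<open>Rotations of order 4 and the symmetries of the cells\<close>

lemma rotation_order:
  assumes "p \<in> {0, 1, 2}" "x \<in> cells"
  shows "((\<lambda>y. step (p + 1) (step p y)) ^^ j) x = x \<longleftrightarrow> 4 dvd j"
proof (rule funpow_eq_self_iff_4)
  obtain c f bx "by" s where x: "x = (c, f, bx, by, s)" by (cases x)
  have "f \<in> range red" using assms(2) by (simp only: x in_cells)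
  then have f: "red f = f" by (rule red_range)
  have ne: "cross f (cross g c) \<noteq> c" if "cross g c \<noteq> cross f c" for g
    using that cross_cross by metis
  \<comment> \<open>For p = 2 two rotations return to the toroidal flag and apply a product of two
    neighbouring involutions to the facet. That product squares to the identity, and by
    \<open>ne\<close> it fixes no facet.\<close>
  have comm: "cross f (cross g (cross f (cross g c))) = c"
    if "cross g (cross f (cross g c)) = cross f (cross g (cross g c))" for g
    unfolding that by (simp add: cross_cross)
  note cross_facts = comm[OF cross_neighbours(1)] comm[OF cross_neighbours(2)] comm[OF cross_neighbours(3)]
    comm[OF cross_neighbours(4)] ne[OF cross_commute(3)] ne[OF cross_commute(4)]
    ne[OF cross_neighbours(5)] ne[OF cross_neighbours(6)]
  consider "p = 0" | "p = 1" | "p = 2" using assms(1) by blast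
  then show "((\<lambda>y. step (p + 1) (step p y)) ^^ 4) x = x"
  proof cases
    case 1
    then show ?thesis
      by (cases s; cases bx; cases "by") (simp_all add: x eval_nat_numeral)
  next
    case 2
    then show ?thesis
      by (cases s; cases bx; cases "by") (simp_all add: x f eval_nat_numeral add.assoc flip: zero_prod_def)
  next
    case 3
    then show ?thesis
      by (cases s; cases bx; cases "by")
        (simp_all add: x f eval_nat_numeral add.assoc cross_facts flip: zero_prod_def)
  qed
  consider "p = 0" | "p = 1" | "p = 2" using assms(1) by blast
  then show "((\<lambda>y. step (p + 1) (step p y)) ^^ 2) x \<noteq> x"
  proof cases
    case 1
    then show ?thesis
      by (cases s; cases bx; cases "by") (simp_all add: x eval_nat_numeral)
  next
    case 2
    then show ?thesis
      by (cases s; cases bx; cases "by") (simp_all add: x f eval_nat_numeral add.assoc flip: zero_prod_def)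
  next
    case 3
    then show ?thesis
      by (cases s; cases bx; cases "by")
        (simp_all add: x f eval_nat_numeral add.assoc cross_facts flip: zero_prod_def)
  qed
qed

lemma red_reflect:
  "red (fst (red u), - snd (red u)) = red (fst u, - snd u)"
  "red (snd (red u), fst (red u)) = red (snd u, fst u)"
  "red (1 - fst (red u), snd (red u)) = red (1 - fst u, snd u)"
proof -
  obtain x y where xy: "red u - u = (x, y)" by (cases "red u - u")
  then have L: "(x, y) \<in> L" using red_minus_in_L by metis
  have "x = fst (red u) - fst u" "y = snd (red u) - snd u"
    using arg_cong[OF xy, of fst] arg_cong[OF xy, of snd] by simp_all
  then have r: "fst (red u) = fst u + x" "snd (red u) = snd u + y" by simp_all
  show "red (fst (red u), - snd (red u)) = red (fst u, - snd u)"
    using L_uminus[OF L_reflect[OF L]] by (simp add: red_eq_iff r)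
  show "red (snd (red u), fst (red u)) = red (snd u, fst u)"
    using L_swap[OF L] by (simp add: red_eq_iff r)
  show "red (1 - fst (red u), snd (red u)) = red (1 - fst u, snd u)"
    using L_reflect[OF L] by (simp add: red_eq_iff r)
qed

text \<open>With square (m, n) drawn as [m, m+1] x [n, n+1], the three mirrors are y = 1/2, x = y
  and x = 1. They bound the triangle of the flag \<open>base\<close>, which consists of the square
  (0, 0), its upper right corner and its right side.\<close>

fun reflect0 :: "cell \<Rightarrow> cell" where
  "reflect0 (c, f, bx, by, s) = (facet_map0 c, red (fst f, - snd f), bx, \<not> by, s)"

fun reflect1 :: "cell \<Rightarrow> cell" where
  "reflect1 (c, f, bx, by, s) = (facet_map1 c, red (snd f, fst f), by, bx, \<not> s)"

fun reflect2 :: "cell \<Rightarrow> cell" where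
  "reflect2 (c, f, bx, by, s) = (facet_map2 c, red (1 - fst f, snd f), \<not> bx, by, s)"

lemma symmetry_reflect: "symmetry reflect0" "symmetry reflect1" "symmetry reflect2"
proof -
  have D: "i = 0 \<or> i = 1 \<or> i = 2 \<or> i = 3" if "i \<in> D" for i using that by (simp add: D_eq)
  have red_add': "red (v + red u) = red (v + u)" for u v
    using red_add[of u v] by (simp only: add.commute)
  have "reflect0 (step i x) = step i (reflect0 x) \<and> reflect1 (step i x) = step i (reflect1 x) \<and>
      reflect2 (step i x) = step i (reflect2 x)" if "i \<in> D" for i x
  proof -
    obtain c m n bx "by" s where x: "x = (c, (m, n), bx, by, s)" by (cases x) auto
    show ?thesis
      using D[OF that]
      by (elim disjE; cases s; cases bx; cases "by")
        (simp_all add: x red_reflect red_add' facet_map_cross algebra_simps)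
  qed
  moreover have "reflect0 x \<in> cells" "reflect1 x \<in> cells" "reflect2 x \<in> cells" for x
    by (cases x; simp add: in_cells)+
  ultimately show "symmetry reflect0" "symmetry reflect1" "symmetry reflect2"
    by (simp_all add: symmetry_def)
qed

definition base :: cell where
  "base = ((False, False, False, False, False), red (0, 0), True, True, True)"

lemma base_cells: "base \<in> cells"
  by (simp add: base_def in_cells)

lemma finite_cells: "finite cells"
  by (simp add: cells_def finite_range_red)

text \<open>A lifted reflection also interchanges the copies, so at \<open>base\<close> it agrees
  with a product of two generators, one of them \<open>step 3\<close>; these are the generators that
  \<open>symmetry_transitive\<close> asks for.\<close>

lemma cells_transitive:
  assumes "x \<in> cells" "y \<in> cells" "cell_par x = cell_par y"
  shows "\<exists>\<phi>. symmetry \<phi> \<and> \<phi> x = y"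
proof (rule symmetry_transitive[OF finite_cells _ base_cells _ assms])
  show "3 \<in> D" by (simp add: D_eq)
  fix i assume "i \<in> D"
  then consider "i = 0" | "i = 1" | "i = 2" | "i = 3" by (auto simp: D_eq)
  then show "\<exists>\<phi>. symmetry \<phi> \<and> \<phi> base = step 3 (step i base)"
  proof cases
    case 1
    have "reflect0 base = step 3 (step 0 base)"
      using red_reflect(1)[of "(0, 0)"] by (simp add: base_def cross_eval)
    then show ?thesis using symmetry_reflect 1 by metis
  next
    case 2
    have "reflect1 base = step 3 (step 1 base)"
      using red_reflect(2)[of "(0, 0)"] by (simp add: base_def cross_eval)
    then show ?thesis using symmetry_reflect 2 by metis
  next
    case 3
    have "reflect2 base = step 3 (step 2 base)"
      using red_reflect(3)[of "(0, 0)"] by (simp add: base_def cross_eval)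
    then show ?thesis using symmetry_reflect 3 by metis
  next
    case 4
    have "step 3 (step 3 base) = base" using step_step base_cells by blast
    then show ?thesis using symmetry_id 4 by metis
  qed
qed

text \<open>The word crosses the squares \<open>(0, 0)\<close>, \<open>(0, 1)\<close>, \<open>(1, 2)\<close>, \<open>(1, 1)\<close> in this order and
  returns; it closes up at \<open>base\<close> but not at \<open>step 3 base\<close>.\<close>

definition chiral_word :: "int list" where
  "chiral_word = [3] @ [1, 2, 1, 0] @ [3] @ [1, 2, 1, 0] @ [2, 1, 0, 1] @ [3] @ [0, 1, 2, 1]
     @ [3] @ [1, 0, 1, 2] @ [0, 1, 2, 1]"

lemma chiral_word_base: "fold step chiral_word base = base"
  by (simp add: chiral_word_def base_def cross_eval)

lemma chiral_word_step_base: "fold step chiral_word (step 3 base) \<noteq> step 3 base"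
  by (simp add: chiral_word_def base_def cross_eval)

lemma symmetry_fold:
  "symmetry \<phi> \<Longrightarrow> x \<in> cells \<Longrightarrow> set w \<subseteq> D \<Longrightarrow> \<phi> (fold step w x) = fold step w (\<phi> x)"
  by (induction w arbitrary: x) (simp_all add: symmetry_act step_closed)

text \<open>A symmetry reversing parity could be composed with a parity-preserving one to carry
  \<open>base\<close> to \<open>step 3 base\<close>. It would then transport the closed word at
  \<open>base\<close> to a closed word there.\<close>

lemma symmetry_cell_par:
  assumes "symmetry \<phi>" "x \<in> cells"
  shows "cell_par (\<phi> x) = cell_par x"
proof (rule ccontr)
  assume "cell_par (\<phi> x) \<noteq> cell_par x"
  then have "cell_par (\<phi> base) \<noteq> cell_par base"
    using symmetry_par[OF assms base_cells] by simp
  then have "cell_par (\<phi> base) = cell_par (step 3 base)" by (simp add: par_step)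
  then obtain \<psi> where \<psi>: "symmetry \<psi>" "\<psi> (\<phi> base) = step 3 base"
    using cells_transitive symmetry_closed[OF assms(1) base_cells] step_closed[OF base_cells] by blast
  have "set chiral_word \<subseteq> D" by (simp add: chiral_word_def D_eq)
  then have "fold step chiral_word (step 3 base) = step 3 base"
    using symmetry_fold[OF symmetry_comp[OF \<psi>(1) assms(1)] base_cells] \<psi>(2) chiral_word_base by metis
  then show False using chiral_word_step_base by contradiction
qed

text \<open>There are 32 facets and 8 flags in each square, and \<open>step 3\<close> exchanges the
  two parities.\<close>

lemma card_even_cells: "card {x \<in> cells. cell_par x = cell_par base} = 128 * card (range red)"
proof -
  let ?E = "{x \<in> cells. cell_par x = cell_par base}"
  let ?O = "{x \<in> cells. cell_par x \<noteq> cell_par base}"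
  have "bij_betw (step 3) ?E ?O"
    by (rule bij_betw_byWitness[where f' = "step 3"])
      (auto simp: step_step par_step intro: step_closed simp del: step.simps)
  then have "card ?O = card ?E" by (simp add: bij_betw_same_card)
  moreover have "card cells = card ?E + card ?O"
    by (subst card_Un_disjoint[symmetric]) (auto simp: finite_cells intro: arg_cong[where f = card])
  moreover have "card cells = 256 * card (range red)"
    by (simp add: cells_def card_cartesian_product flip: UNIV_Times_UNIV)
  ultimately show ?thesis by simp
qed

theorem exists_chiral_polytope_444:
  "\<exists>(r :: nat rel) (rank :: nat \<Rightarrow> int).
     chiral_polytope r rank 4 \<and> has_schlaefli_type r rank 4 [4, 4, 4] \<and>
     order (automorphism_group r) = 128 * card (range red)"
proof -
  interpret flag_system 4 step cells cell_par "face_code 4 step" rank_code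
    by (rule flag_system_face_code) (rule flag_graph_cells)
  interpret chiral_flag_system 4 step cells cell_par "face_code 4 step" rank_code
    by unfold_locales (use finite_cells cells_transitive symmetry_cell_par in auto)
  have "has_schlaefli_type face_order rank_code 4 [4, 4, 4]"
    unfolding has_schlaefli_type_def
  proof (intro conjI ballI allI impI)
    fix i F G assume i: "i \<in> {1..4 - 1 :: nat}"
      and FG: "(F, G) \<in> face_order \<and> rank_code F = int i - 2 \<and> rank_code G = int i + 1"
    have "i = 1 \<or> i = 2 \<or> i = 3" using i by auto
    then have p: "int i - 1 \<in> {0, 1, 2}" "[4, 4, 4] ! (i - 1) = (4 :: nat)" by auto
    show "\<exists>f. order_isomorphism (face_section face_order G F) (polygon_lattice ([4, 4, 4] ! (i - 1))) f"
      unfolding p(2)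
    \<comment> \<open>The i-th entry of the type is the order of the product of the generators with
      labels i - 1 and i.\<close>
    proof (rule section_polygon[of "int i - 1"])
      show "((\<lambda>y. step (int i - 1 + 1) (step (int i - 1) y)) ^^ j) x = x \<longleftrightarrow> 4 dvd j"
        if "x \<in> cells" for x j
        using p(1) that by (rule rotation_order)
    qed (use p(1) FG in \<open>auto simp: D_eq\<close>)
  qed simp
  then show ?thesis
    using chiral_polytope_face_order order_automorphism_group[OF base_cells] card_even_cells by auto
qed

end

section \<open>Two families of tori\<close>

lemma card_int_box: "card ({0..<int m} \<times> {0..<int n}) = m * n"
  by (simp add: card_cartesian_product)

definition red_straight :: "int \<Rightarrow> int \<times> int \<Rightarrow> int \<times> int" where
  "red_straight t = (\<lambda>(x, y). (x mod t, y mod t))"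

lemma range_red_straight:
  assumes "0 < t"
  shows "range (red_straight t) = {0..<t} \<times> {0..<t}"
proof
  show "range (red_straight t) \<subseteq> {0..<t} \<times> {0..<t}"
    using assms by (auto simp: red_straight_def)
  have "v = red_straight t v" if "v \<in> {0..<t} \<times> {0..<t}" for v
    using that by (auto simp: red_straight_def)
  then show "{0..<t} \<times> {0..<t} \<subseteq> range (red_straight t)" by blast
qed

lemma square_torus_straight:
  assumes "0 < t" "4 dvd t"
  shows "square_torus (red_straight t) {(x, y). t dvd x \<and> t dvd y}"
proof
  show "red_straight t u = red_straight t v \<longleftrightarrow> u - v \<in> {(x, y). t dvd x \<and> t dvd y}" for u v
    by (cases u; cases v) (simp add: red_straight_def mod_eq_dvd_iff)
  show "red_straight t (red_straight t u) = red_straight t u" for u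
    by (cases u) (simp add: red_straight_def)
  show "even x \<and> even y \<and> even (x div 2 + y div 2)"
    if "(x, y) \<in> {(x, y). t dvd x \<and> t dvd y}" for x y
  proof -
    have "4 dvd x" "4 dvd y" using that assms(2) dvd_trans by auto
    then show ?thesis by presburger
  qed
  show "finite (range (red_straight t))" using range_red_straight[OF assms(1)] by simp
qed auto

text \<open>Normal form modulo the lattice spanned by (t, t) and (2 t, 0): multiples of (t, t) bring
  y into range, and multiples of (2 t, 0) then reduce x.\<close>

definition red_diagonal :: "int \<Rightarrow> int \<times> int \<Rightarrow> int \<times> int" where
  "red_diagonal t = (\<lambda>(x, y). ((x - t * (y div t)) mod (2 * t), y mod t))"

lemma range_red_diagonal:
  assumes "0 < t"
  shows "range (red_diagonal t) = {0..<2 * t} \<times> {0..<t}"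
proof
  show "range (red_diagonal t) \<subseteq> {0..<2 * t} \<times> {0..<t}"
    using assms by (auto simp: red_diagonal_def)
  have "v = red_diagonal t v" if "v \<in> {0..<2 * t} \<times> {0..<t}" for v
    using that by (auto simp: red_diagonal_def)
  then show "{0..<2 * t} \<times> {0..<t} \<subseteq> range (red_diagonal t)" by blast
qed

lemma square_torus_diagonal:
  assumes "0 < t" "even t"
  shows "square_torus (red_diagonal t) {(t * (k + 2 * l), t * k) | k l. True}"
proof
  show "red_diagonal t u = red_diagonal t v \<longleftrightarrow> u - v \<in> {(t * (k + 2 * l), t * k) | k l. True}" for u v
  proof -
    obtain x y where u: "u = (x, y)" by (cases u)
    obtain x' y' where v: "v = (x', y')" by (cases v)
    have "red_diagonal t u = red_diagonal t v \<longleftrightarrow>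
        2 * t dvd (x - t * (y div t)) - (x' - t * (y' div t)) \<and> y mod t = y' mod t"
      by (simp add: red_diagonal_def u v mod_eq_dvd_iff)
    also have "\<dots> \<longleftrightarrow> (\<exists>k l. x - x' = t * (k + 2 * l) \<and> y - y' = t * k)"
    proof
      assume *: "2 * t dvd (x - t * (y div t)) - (x' - t * (y' div t)) \<and> y mod t = y' mod t"
      then obtain l where l: "(x - t * (y div t)) - (x' - t * (y' div t)) = 2 * t * l" by (elim conjE dvdE)
      have "y - y' = t * (y div t - y' div t)"
        unfolding right_diff_distrib minus_mod_eq_mult_div[symmetric] using * by simp
      moreover have "x - x' = t * ((y div t - y' div t) + 2 * l)"
        using l by (simp add: algebra_simps)
      ultimately show "\<exists>k l. x - x' = t * (k + 2 * l) \<and> y - y' = t * k" by blast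
    next
      assume "\<exists>k l. x - x' = t * (k + 2 * l) \<and> y - y' = t * k"
      then obtain k l where kl: "x = x' + t * (k + 2 * l)" "y = y' + t * k"
        by (metis diff_eq_eq add.commute)
      have "y div t = y' div t + k" "y mod t = y' mod t" using assms(1) by (simp_all add: kl)
      moreover from this have "(x - t * (y div t)) - (x' - t * (y' div t)) = 2 * t * l"
        by (simp add: kl(1) algebra_simps)
      ultimately show "2 * t dvd (x - t * (y div t)) - (x' - t * (y' div t)) \<and> y mod t = y' mod t"
        by simp
    qed
    finally show ?thesis by (auto simp: u v)
  qed
  show "red_diagonal t (red_diagonal t u) = red_diagonal t u" for u
    using assms(1) by (cases u) (simp add: red_diagonal_def)
  show "even x \<and> even y \<and> even (x div 2 + y div 2)"
    if xy: "(x, y) \<in> {(t * (k + 2 * l), t * k) | k l. True}" for x y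
  proof -
    obtain k l where kl: "x = t * (k + 2 * l)" "y = t * k" using xy by blast
    obtain h where t: "t = 2 * h" using assms(2) by (elim evenE)
    have "x div 2 + y div 2 = 2 * (h * (k + l))" by (simp add: kl t algebra_simps)
    then show ?thesis by (simp add: kl t)
  qed
  show "(- x, y) \<in> {(t * (k + 2 * l), t * k) | k l. True}"
    if xy: "(x, y) \<in> {(t * (k + 2 * l), t * k) | k l. True}" for x y
  proof -
    obtain k l where "x = t * (k + 2 * l)" "y = t * k" using xy by blast
    then have "- x = t * (k + 2 * (- k - l))" "y = t * k" by (simp_all add: algebra_simps)
    then show ?thesis by blast
  qed
  show "(y, x) \<in> {(t * (k + 2 * l), t * k) | k l. True}"
    if xy: "(x, y) \<in> {(t * (k + 2 * l), t * k) | k l. True}" for x y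
  proof -
    obtain k l where "x = t * (k + 2 * l)" "y = t * k" using xy by blast
    then have "y = t * ((k + 2 * l) + 2 * (- l))" "x = t * (k + 2 * l)" by (simp_all add: algebra_simps)
    then show ?thesis by blast
  qed
  show "finite (range (red_diagonal t))" using range_red_diagonal[OF assms(1)] by simp
qed

theorem corollary3p2:
  fixes n :: nat
  assumes "n \<ge> 10"
  shows "\<exists>(r :: nat rel) (rank :: nat \<Rightarrow> int).
           chiral_polytope r rank 4 \<and>
           has_schlaefli_type r rank 4 [4, 4, 4] \<and>
           order (automorphism_group r) = 2 ^ n"
proof -
  have "\<exists>red L. square_torus red L \<and> 128 * card (range red) = 2 ^ n"
  proof (cases "odd n")
    case True
    then obtain m where "n = 2 * m + 1" by (elim oddE)
    define k where "k = m - 5"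
    then have n: "n = 2 * k + 11" using \<open>n = 2 * m + 1\<close> assms by simp
    \<comment> \<open>The straight torus has t^2 squares and needs 4 to divide t; this gives the odd
      exponents from 11 on.\<close>
    define t :: nat where "t = 4 * 2 ^ k"
    have "square_torus (red_straight (int t)) {(x, y). int t dvd x \<and> int t dvd y}"
      by (rule square_torus_straight) (simp_all add: t_def)
    moreover have "card (range (red_straight (int t))) = t * t"
      using range_red_straight[of "int t"] card_int_box[of t t] by (simp add: t_def)
    moreover have "128 * (t * t) = 2 ^ n"
      by (simp add: n t_def power_add power_mult power2_eq_square flip: power_mult_distrib)
    ultimately have "square_torus (red_straight (int t)) {(x, y). int t dvd x \<and> int t dvd y} \<and>
        128 * card (range (red_straight (int t))) = 2 ^ n"
      by simp
    then show ?thesis by blast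
  next
    case False
    then obtain m where "n = 2 * m" by (auto elim: evenE)
    define k where "k = m - 5"
    then have n: "n = 2 * k + 10" using \<open>n = 2 * m\<close> assms by simp
    \<comment> \<open>The diagonal torus has 2 t^2 squares and allows every even t; this gives the
      even exponents from 10 on.\<close>
    define t :: nat where "t = 2 * 2 ^ k"
    define L where "L = {(int t * (i + 2 * j), int t * i) | i j. True}"
    have "square_torus (red_diagonal (int t)) L"
      unfolding L_def by (rule square_torus_diagonal) (simp_all add: t_def)
    moreover have "card (range (red_diagonal (int t))) = (2 * t) * t"
      using range_red_diagonal[of "int t"] card_int_box[of "2 * t" t] by (simp add: t_def)
    moreover have "128 * ((2 * t) * t) = 2 ^ n"
      by (simp add: n t_def power_add power_mult power2_eq_square flip: power_mult_distrib)
    ultimately have "square_torus (red_diagonal (int t)) L \<and>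
        128 * card (range (red_diagonal (int t))) = 2 ^ n"
      by simp
    then show ?thesis by blast
  qed
  then obtain red L where "square_torus red L" and card: "128 * card (range red) = 2 ^ n" by blast
  then interpret square_torus red L by simp
  show ?thesis using exists_chiral_polytope_444 unfolding card .
qed

end
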